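(* Let $r\ge0$ and $n\ge1$ be integers and write $z=u/(1+u)^2$. The factorial moments of $X_{n,r}$ are $$\mathbb{E}X_{n,r}=\frac1{C_{n-1}}[z^n]\frac{u(1+u^{r+1})}{(1+u)(1-u^{r+2})},\qquad \mathbb{E}X_{n,r}(X_{n,r}-1)=\frac{2}{C_{n-1}}[z^n]\frac{(1+u)u^{r+2}}{(1-u)(1-u^{r+2})^2},$$ and, for all $d\ge2$, $$\mathbb{E}X_{n,r}^{\underline d}=\frac{d!}{C_{n-1}}[z^n]\frac{1-u}{1+u}\biggl(\frac{u(1+u^{r+1})}{(1-u)(1-u^{r+2})}+\frac{u}{1-u}\sqrt{\frac{1-u^r}{1-u^{r+2}}}\biggr)^d\,\tilde N_{d-1}(Q_r),$$ where $$Q_r=\frac{2u^{2r+2}-u^{r+2}+2u^{r+1}-u^r+2}{(1+u)^2u^r}-\frac{2(1+u^{r+1})(1-u^{r+2})}{u^r(1+u)^2}\sqrt{\frac{1-u^r}{1-u^{r+2}}}.$$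
   Context: A plane tree is a finite rooted tree in which the children of every node are linearly ordered (from left to right); its size is its number of nodes. There are $C_{n-1}$ plane trees of size $n$, where $C_m=\frac1{m+1}\binom{2m}{m}$. A path is a plane tree in which every node has at most one child (including the single-node tree). For a plane tree $\tau$, $\rho(\tau)$ is the plane tree obtained by cutting all old paths, i.e. by simultaneously deleting every non-root node $v$ such that $v$ is the leftmost child of its parent and the subtree of $\tau$ consisting of $v$ and all its descendants is a path; the single-node tree is mapped to itself. $X_{n,r}$ is the size of $\rho^r(\tau)$, where $\tau$ is uniformly random among all plane trees of size $n$. Associated Narayana polynomials: $\tilde N_m(x)=\sum_{k=1}^m\frac1m\binom{m}{k-1}\binom mk x^k$ for $m\ge1$ (and $\tilde N_0(x)=x$). The substitution $z=u/(1+u)^2$ means that $u=u(z)$ is the power series in $z$ with $u(0)=0$ satisfying this equation; expressions in $u$ are viewed as (Laurent) series in $z$ and $[z^n]$ extracts the coefficient of $z^n$. For $r\ge1$ the square root denotes the power series with constant term $1$; for $r=0$ it is $0$. Falling factorial: $x^{\underline d}=x(x-1)\cdots(x-d+1)$. *)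

theory Defs
  imports
    "HOL-Probability.Probability_Mass_Function"
    "HOL-Computational_Algebra.Formal_Laurent_Series"
begin

section \<open>Plane trees and the cutting of old paths\<close>

datatype plane_tree = Node "plane_tree list"

text \<open>The automatically generated \<open>size\<close> function also counts list constructors, so the
  number of nodes is defined separately.\<close>

fun nodes :: "plane_tree \<Rightarrow> nat" where
  "nodes (Node ts) = 1 + (\<Sum>t\<leftarrow>ts. nodes t)"

fun is_path :: "plane_tree \<Rightarrow> bool" where
  "is_path (Node ts) \<longleftrightarrow> length ts \<le> 1 \<and> (\<forall>t\<in>set ts. is_path t)"

text \<open>The test \<open>is_path t\<close> is always applied to subtrees of the original tree, so all deletions
  are simultaneous.  Dropping a whole path \<open>t\<close> is the same as deleting its nodes one by one:
  every non-root node of \<open>t\<close> is itself a leftmost child whose subtree is a path.\<close>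

fun rho :: "plane_tree \<Rightarrow> plane_tree" where
  "rho (Node []) = Node []"
| "rho (Node (t # ts)) = Node (if is_path t then map rho ts else rho t # map rho ts)"

definition plane_trees :: "nat \<Rightarrow> plane_tree set" where
  "plane_trees n = {t. nodes t = n}"

definition X :: "nat \<Rightarrow> plane_tree \<Rightarrow> nat" where
  "X r t = nodes ((rho ^^ r) t)"

definition expect :: "nat \<Rightarrow> (plane_tree \<Rightarrow> real) \<Rightarrow> real" where
  "expect n f = measure_pmf.expectation (pmf_of_set (plane_trees n)) f"

text \<open>The set of plane trees of size \<open>n \<ge> 1\<close> is finite and nonempty, so \<open>pmf_of_set\<close> above is
  the uniform distribution.\<close>

lemma nodes_pos: "nodes t \<ge> 1"
  by (cases t) auto

lemma length_le_sum_nodes: "length ts \<le> (\<Sum>t\<leftarrow>ts. nodes t)"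
proof (induction ts)
  case (Cons t ts)
  then show ?case using nodes_pos[of t] by simp
qed simp

lemma finite_plane_trees_le: "finite {t. nodes t \<le> n}"
proof (induction n)
  case 0
  have "{t. nodes t \<le> 0} = {}"
    using nodes_pos by (auto simp: Suc_le_eq)
  then show ?case by (simp only: finite.emptyI)
next
  case (Suc n)
  have "{t. nodes t \<le> Suc n} \<subseteq> Node ` {ts. set ts \<subseteq> {t. nodes t \<le> n} \<and> length ts \<le> n}"
  proof
    fix t assume "t \<in> {t. nodes t \<le> Suc n}"
    then obtain ts where t: "t = Node ts" and s: "(\<Sum>t\<leftarrow>ts. nodes t) \<le> n"
      by (cases t) auto
    have "nodes t' \<le> n" if "t' \<in> set ts" for t'
    proof -
      have "nodes t' \<le> (\<Sum>t\<leftarrow>ts. nodes t)"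
        using that by (simp add: member_le_sum_list)
      then show ?thesis using s by simp
    qed
    moreover have "length ts \<le> n" using length_le_sum_nodes[of ts] s by simp
    ultimately show "t \<in> Node ` {ts. set ts \<subseteq> {t. nodes t \<le> n} \<and> length ts \<le> n}"
      using t by auto
  qed
  then show ?case
    using finite_lists_length_le[OF Suc.IH] by (meson finite_imageI finite_subset)
qed

lemma finite_plane_trees: "finite (plane_trees n)"
  unfolding plane_trees_def by (rule finite_subset[OF _ finite_plane_trees_le[of n]]) auto

lemma plane_trees_nonempty:
  assumes "n \<ge> 1"
  shows "plane_trees n \<noteq> {}"
proof -
  have "Node (replicate (n - 1) (Node [])) \<in> plane_trees n"
    using assms by (simp add: plane_trees_def sum_list_replicate)
  then show ?thesis by blast
qed


section \<open>Numbers and polynomials\<close>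

definition catalan :: "nat \<Rightarrow> real" where
  "catalan m = 1 / (real m + 1) * real ((2 * m) choose m)"

definition falling_factorial :: "real \<Rightarrow> nat \<Rightarrow> real" where
  "falling_factorial x d = (\<Prod>i<d. x - real i)"

text \<open>Associated Narayana polynomials, as polynomial functions on an arbitrary field of
  characteristic 0; they are evaluated at formal Laurent series below.\<close>

definition assoc_narayana :: "nat \<Rightarrow> 'a::field_char_0 \<Rightarrow> 'a" where
  "assoc_narayana m x =
     (if m = 0 then x
      else (\<Sum>k=1..m. 1 / of_nat m * of_nat (m choose (k - 1)) * of_nat (m choose k) * x ^ k))"


section \<open>The series in \<open>u\<close>\<close>

text \<open>The substitution \<open>z = u / (1 + u)\<^sup>2\<close>, where \<open>z\<close> is the indeterminate \<^const>\<open>fps_X\<close>.\<close>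

definition is_substitution :: "real fps \<Rightarrow> bool" where
  "is_substitution u \<longleftrightarrow> fps_nth u 0 = 0 \<and> fps_X = u / (1 + u)\<^sup>2"

lemma ex1_substitution: "\<exists>!u. is_substitution u"
proof -
  define a :: "real fps" where "a = fps_X / (1 + fps_X)\<^sup>2"
  have unit: "fps_nth ((1 + v)\<^sup>2) 0 \<noteq> 0" if "fps_nth v 0 = 0" for v :: "real fps"
    using that by (simp add: fps_power_zeroth)
  have a_eq: "a = fps_X * inverse ((1 + fps_X)\<^sup>2)"
    unfolding a_def by (rule fps_divide_unit) (rule unit, simp)
  have a0: "fps_nth a 0 = 0" by (simp add: a_eq)
  have a1: "fps_nth a 1 \<noteq> 0"
    by (simp add: a_eq fps_power_zeroth)
  have comp: "a oo v = v / (1 + v)\<^sup>2" if v: "fps_nth v 0 = 0" for v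
  proof -
    have "a oo v = (fps_X oo v) * (inverse ((1 + fps_X)\<^sup>2) oo v)"
      unfolding a_eq by (rule fps_compose_mult_distrib[OF v])
    also have "inverse ((1 + fps_X)\<^sup>2) oo v = inverse ((1 + fps_X)\<^sup>2 oo v)"
      by (rule fps_inverse_compose[OF v]) (rule unit, simp)
    also have "(1 + fps_X :: real fps)\<^sup>2 oo v = (1 + v)\<^sup>2"
      using v by (simp add: fps_compose_power [symmetric] fps_compose_add_distrib)
    finally show ?thesis
      using fps_divide_unit[OF unit[OF v], of v] v by simp
  qed
  have iff: "is_substitution v \<longleftrightarrow> fps_nth v 0 = 0 \<and> a oo v = fps_X" for v
    unfolding is_substitution_def using comp[of v] by auto
  show ?thesis
  proof
    show "is_substitution (fps_inv a)"
      unfolding iff using fps_inv_right[OF a0 a1] by (simp add: fps_inv_def)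
  next
    fix v assume "is_substitution v"
    then have v: "fps_nth v 0 = 0" "a oo v = fps_X" by (auto simp: iff)
    have "fps_inv a oo (a oo v) = (fps_inv a oo a) oo v"
      by (rule fps_compose_assoc[OF v(1) a0])
    then show "v = fps_inv a"
      using v fps_inv[OF a0 a1] by simp
  qed
qed

text \<open>The square root of \<open>(1 - u\<^sup>r) / (1 - u\<^sup>r\<^sup>+\<^sup>2)\<close> as a power series, with constant term 1
  for \<open>r \<ge> 1\<close>.\<close>

definition sqrt_series :: "nat \<Rightarrow> real fps \<Rightarrow> real fps" where
  "sqrt_series r u =
     (if r = 0 then 0 else fps_radical root 2 ((1 - u ^ r) / (1 - u ^ (r + 2))))"

lemma sqrt_series:
  assumes "fps_nth u 0 = 0"
  shows "(sqrt_series r u)\<^sup>2 = (1 - u ^ r) / (1 - u ^ (r + 2))"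
    and "r \<ge> 1 \<Longrightarrow> fps_nth (sqrt_series r u) 0 = 1"
proof -
  have u: "fps_nth (u ^ k) 0 = 0" if "k \<ge> 1" for k
    using assms that by (simp add: fps_power_zeroth)
  have c: "fps_nth ((1 - u ^ r) / (1 - u ^ (r + 2))) 0 = 1" if "r \<ge> 1"
  proof -
    have "fps_nth (1 - u ^ (r + 2)) 0 = 1" "fps_nth (1 - u ^ r) 0 = 1"
      unfolding fps_sub_nth using u[of "r + 2"] u[OF that] by simp_all
    then show ?thesis
      using fps_divide_unit[of "1 - u ^ (r + 2)" "1 - u ^ r"]
      by (simp del: power_Suc add_2_eq_Suc' fps_sub_nth)
  qed
  show "(sqrt_series r u)\<^sup>2 = (1 - u ^ r) / (1 - u ^ (r + 2))"
  proof (cases "r = 0")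
    case False
    then show ?thesis
      using power_radical[of "(1 - u ^ r) / (1 - u ^ (r + 2))" root 1] c
      by (simp add: sqrt_series_def numeral_2_eq_2)
  qed (simp add: sqrt_series_def)
  show "fps_nth (sqrt_series r u) 0 = 1" if "r \<ge> 1"
    using that c[OF that] by (simp add: sqrt_series_def)
qed

text \<open>Since \<open>u\<^sup>r\<close> occurs in a denominator, \<open>Q\<^sub>r\<close> and all right-hand sides are computed in the
  field of formal Laurent series; the arguments \<open>u\<close> and \<open>s\<close> (the square root) are Laurent series
  in \<open>z\<close>.\<close>

definition Q :: "nat \<Rightarrow> real fls \<Rightarrow> real fls \<Rightarrow> real fls" where
  "Q r u s =
     (2 * u ^ (2 * r + 2) - u ^ (r + 2) + 2 * u ^ (r + 1) - u ^ r + 2) / ((1 + u)\<^sup>2 * u ^ r)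
     - 2 * (1 + u ^ (r + 1)) * (1 - u ^ (r + 2)) / (u ^ r * (1 + u)\<^sup>2) * s"

end

theory Submission
  imports Defs
begin

unbundle no vec_syntax
unbundle fps_syntax

text \<open>
  Call a leaf old if it is the leftmost child of its parent, and let a plane tree have the weight
  \<open>z\<^sup>m t\<^sup>k\<close> if it has \<open>k\<close> old leaves and \<open>m\<close> other nodes.  A tree \<open>\<tau>\<close> with \<open>rho \<tau> = \<sigma>\<close> arises
  from \<open>\<sigma>\<close> by placing, in front of the children of every node, either nothing or one path; where
  the first child in \<open>\<sigma>\<close> is a leaf, the path is compulsory, as otherwise that child would be the
  remainder of a path, and the whole path would have been cut.  A path in the first position
  contains exactly one old leaf, so all these paths together weigh \<open>q = t + z t + \<dots> = t / (1 - z)\<close>,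
  and all the trees that \<open>rho\<close> maps to \<open>\<sigma>\<close> together weigh what \<open>\<sigma>\<close> weighs with \<open>(z, t)\<close> replaced by
  \<open>(z (1 + q), z q)\<close>: lemma \<open>has_formal_sum_rho_fibre\<close>.  Counting the trees of size \<open>n\<close> by their
  size after \<open>r\<close> cuts thus means iterating this substitution \<open>r\<close> times from \<open>z = t = X\<close>.  In terms
  of \<open>u\<close>, where \<open>X = u / (1 + u)\<^sup>2\<close>, the iterates have a closed form, \<open>z_series\<close> and \<open>t_series\<close>
  below.

  Splitting off the first child of the root gives a quadratic equation for the total weight \<open>G\<close> of
  all plane trees: lemma \<open>weight_sum_functional_equation\<close>.  Multiplying both variables by \<open>1 + y\<close>
  turns the coefficient of \<open>y\<^sup>d\<close> in \<open>G\<close> into the sum of the binomial coefficients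
  \<open>X\<^sub>n\<^sub>,\<^sub>r choose d\<close>, that is, into the factorial moments up to normalisation; the coefficient of
  \<open>y\<^sup>0\<close> counts the trees.

  With \<open>w = (1 - u) / (1 + u)\<close>, the closed form of the parameters makes the discriminant of the
  quadratic equation equal to \<open>w\<^sup>2 (1 - 4 A y + 4 B\<^sup>2 y\<^sup>2)\<close>, where
  \<open>A = u (1 + u\<^sup>r\<^sup>+\<^sup>1) / ((1 - u) (1 - u\<^sup>r\<^sup>+\<^sup>2))\<close> and \<open>B\<close> is \<open>u / (1 - u)\<close> times the square root in the
  statement.  This is the discriminant of \<open>K = y (p + K) (q + K)\<close> for \<open>p = A + B\<close> and \<open>q = A - B\<close>,
  and \<open>G = (1 - w) / 2 + w y (A + K)\<close>.  Lagrange inversion gives the coefficients of \<open>K\<close> as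
  homogeneous Narayana polynomials in \<open>p\<close> and \<open>q\<close>: lemma \<open>narayana_series_nth\<close>.  The quantity
  \<open>Q\<^sub>r\<close> is the quotient \<open>q / p\<close>.
\<close>

section \<open>Sums of infinitely many formal power series\<close>

text \<open>Coefficientwise finite sums.  The finite set may depend on the coefficient, and it may be
  larger than necessary, so that sets of trees bounded in size can be used.\<close>
definition has_formal_sum :: "('i \<Rightarrow> 'a::comm_monoid_add fps) \<Rightarrow> 'i set \<Rightarrow> 'a fps \<Rightarrow> bool" where
  "has_formal_sum f I S \<longleftrightarrow>
     (\<forall>n. \<exists>J\<subseteq>I. finite J \<and> (\<forall>i\<in>I - J. f i $ n = 0) \<and> S $ n = (\<Sum>i\<in>J. f i $ n))"

lemma has_formal_sum_nth:
  assumes "has_formal_sum f I S" "finite J" "J \<subseteq> I" "\<And>i. i \<in> I - J \<Longrightarrow> f i $ n = 0"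
  shows "S $ n = (\<Sum>i\<in>J. f i $ n)"
proof -
  obtain K where K: "K \<subseteq> I" "finite K" "\<forall>i\<in>I - K. f i $ n = 0" "S $ n = (\<Sum>i\<in>K. f i $ n)"
    using assms(1) unfolding has_formal_sum_def by blast
  have "(\<Sum>i\<in>K. f i $ n) = (\<Sum>i\<in>J \<union> K. f i $ n)"
    by (rule sum.mono_neutral_left) (use K assms in auto)
  also have "\<dots> = (\<Sum>i\<in>J. f i $ n)"
    by (rule sum.mono_neutral_right) (use K assms in auto)
  finally show ?thesis using K by simp
qed

lemma has_formal_sum_unique:
  assumes "has_formal_sum f I S" "has_formal_sum f I T"
  shows "S = T"
proof (rule fps_ext)
  fix n
  obtain J where J: "J \<subseteq> I" "finite J" "\<forall>i\<in>I - J. f i $ n = 0" "S $ n = (\<Sum>i\<in>J. f i $ n)"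
    using assms(1) unfolding has_formal_sum_def by blast
  then show "S $ n = T $ n"
    using has_formal_sum_nth[OF assms(2), of J n] by simp
qed

lemma has_formal_sum_exists:
  assumes "\<And>n. finite {i \<in> I. f i $ n \<noteq> 0}"
  shows "\<exists>S. has_formal_sum f I S"
proof
  show "has_formal_sum f I (Abs_fps (\<lambda>n. \<Sum>i | i \<in> I \<and> f i $ n \<noteq> 0. f i $ n))"
    unfolding has_formal_sum_def using assms by (auto intro!: exI[of _ "{i \<in> I. f i $ _ \<noteq> 0}"])
qed

lemma has_formal_sum_singleton: "has_formal_sum f {i} (f i)"
  unfolding has_formal_sum_def by (intro allI exI[of _ "{i}"]) auto

lemma has_formal_sum_union:
  assumes "has_formal_sum f I S" "has_formal_sum f J T" "I \<inter> J = {}"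
  shows "has_formal_sum f (I \<union> J) (S + T)"
  unfolding has_formal_sum_def
proof
  fix n
  obtain I' where I': "I' \<subseteq> I" "finite I'" "\<forall>i\<in>I - I'. f i $ n = 0" "S $ n = (\<Sum>i\<in>I'. f i $ n)"
    using assms(1) unfolding has_formal_sum_def by blast
  obtain J' where J': "J' \<subseteq> J" "finite J'" "\<forall>i\<in>J - J'. f i $ n = 0" "T $ n = (\<Sum>i\<in>J'. f i $ n)"
    using assms(2) unfolding has_formal_sum_def by blast
  have "(S + T) $ n = (\<Sum>i\<in>I' \<union> J'. f i $ n)"
    using I' J' assms(3) by (subst sum.union_disjoint) auto
  then show "\<exists>K\<subseteq>I \<union> J. finite K \<and> (\<forall>i\<in>I \<union> J - K. f i $ n = 0) \<and> (S + T) $ n = (\<Sum>i\<in>K. f i $ n)"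
    using I' J' by (intro exI[of _ "I' \<union> J'"]) auto
qed

lemma has_formal_sum_fun_upd:
  fixes f :: "'i \<Rightarrow> 'a::ab_group_add fps"
  assumes "has_formal_sum f I S" "a \<in> I"
  shows "has_formal_sum (f(a := b)) I (S - f a + b)"
  unfolding has_formal_sum_def
proof
  fix n
  obtain J where J: "J \<subseteq> I" "finite J" "\<forall>i\<in>I - J. f i $ n = 0"
    using assms(1) unfolding has_formal_sum_def by blast
  have "S $ n = (\<Sum>i\<in>insert a J. f i $ n)"
    by (rule has_formal_sum_nth[OF assms(1)]) (use J assms(2) in auto)
  also have "\<dots> = f a $ n + (\<Sum>i\<in>J - {a}. f i $ n)"
    using J(2) by (rule sum.insert_remove)
  also have "(\<Sum>i\<in>J - {a}. f i $ n) = (\<Sum>i\<in>J - {a}. (f(a := b)) i $ n)"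
    by (rule sum.cong) auto
  finally have "(S - f a + b) $ n = (\<Sum>i\<in>insert a J. (f(a := b)) i $ n)"
    using J(2) by (simp add: sum.insert_remove)
  then show "\<exists>K\<subseteq>I. finite K \<and> (\<forall>i\<in>I - K. (f(a := b)) i $ n = 0) \<and>
      (S - f a + b) $ n = (\<Sum>i\<in>K. (f(a := b)) i $ n)"
    using J assms(2) by (intro exI[of _ "insert a J"]) auto
qed

lemma has_formal_sum_reindex:
  assumes "inj_on h I" "has_formal_sum (\<lambda>i. f (h i)) I S"
  shows "has_formal_sum f (h ` I) S"
  unfolding has_formal_sum_def
proof
  fix n
  obtain J where J: "J \<subseteq> I" "finite J" "\<forall>i\<in>I - J. f (h i) $ n = 0" "S $ n = (\<Sum>i\<in>J. f (h i) $ n)"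
    using assms(2) unfolding has_formal_sum_def by blast
  have "inj_on h J" using assms(1) J(1) by (rule inj_on_subset)
  then have "S $ n = (\<Sum>i\<in>h ` J. f i $ n)"
    using J by (simp add: sum.reindex)
  then show "\<exists>K\<subseteq>h ` I. finite K \<and> (\<forall>i\<in>h ` I - K. f i $ n = 0) \<and> S $ n = (\<Sum>i\<in>K. f i $ n)"
    using J by (intro exI[of _ "h ` J"]) auto
qed

lemma has_formal_sum_cong:
  assumes "\<And>i. i \<in> I \<Longrightarrow> f i = g i" "has_formal_sum f I S"
  shows "has_formal_sum g I S"
proof -
  have *: "(\<Sum>i\<in>J. f i $ n) = (\<Sum>i\<in>J. g i $ n)" if "J \<subseteq> I" for J n
    using that assms(1) by (intro sum.cong) auto
  show ?thesis
    using assms(2) unfolding has_formal_sum_def by (metis (no_types, lifting) "*" Diff_iff assms(1))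
qed

lemma has_formal_sum_prod:
  fixes f :: "'i \<Rightarrow> 'a::comm_semiring_1 fps"
  assumes "has_formal_sum f I S" "has_formal_sum g J T"
  shows "has_formal_sum (\<lambda>(i, j). f i * g j) (I \<times> J) (S * T)"
  unfolding has_formal_sum_def
proof
  fix n
  obtain I' where I': "\<And>k. I' k \<subseteq> I" "\<And>k. finite (I' k)" "\<And>k. \<forall>i\<in>I - I' k. f i $ k = 0"
    using assms(1) unfolding has_formal_sum_def by metis
  obtain J' where J': "\<And>k. J' k \<subseteq> J" "\<And>k. finite (J' k)" "\<And>k. \<forall>i\<in>J - J' k. g i $ k = 0"
    using assms(2) unfolding has_formal_sum_def by metis
  define K where "K = (\<Union>k\<le>n. I' k)"
  define L where "L = (\<Union>k\<le>n. J' k)"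
  have KL: "finite K" "finite L" "K \<subseteq> I" "L \<subseteq> J"
    using I'(2) J'(2) UN_least[OF I'(1)] UN_least[OF J'(1)] unfolding K_def L_def by simp_all
  have f0: "f i $ k = 0" if "i \<in> I - K" "k \<le> n" for i k
    using I'(3)[of k] that unfolding K_def by auto
  have g0: "g j $ k = 0" if "j \<in> J - L" "k \<le> n" for j k
    using J'(3)[of k] that unfolding L_def by auto
  have S: "S $ k = (\<Sum>i\<in>K. f i $ k)" if "k \<le> n" for k
    by (rule has_formal_sum_nth[OF assms(1)]) (use KL f0 that in auto)
  have T: "T $ k = (\<Sum>j\<in>L. g j $ k)" if "k \<le> n" for k
    by (rule has_formal_sum_nth[OF assms(2)]) (use KL g0 that in auto)
  have "(S * T) $ n = (\<Sum>k=0..n. \<Sum>i\<in>K. \<Sum>j\<in>L. f i $ k * g j $ (n - k))"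
    unfolding fps_mult_nth by (intro sum.cong refl) (simp add: S T sum_product)
  also have "\<dots> = (\<Sum>i\<in>K. \<Sum>j\<in>L. \<Sum>k=0..n. f i $ k * g j $ (n - k))"
    by (subst sum.swap) (intro sum.cong refl, subst sum.swap, rule refl)
  also have "\<dots> = (\<Sum>p\<in>K \<times> L. (case p of (i, j) \<Rightarrow> f i * g j) $ n)"
    by (simp add: sum.cartesian_product' fps_mult_nth case_prod_unfold)
  finally have "(S * T) $ n = (\<Sum>p\<in>K \<times> L. (case p of (i, j) \<Rightarrow> f i * g j) $ n)" .
  moreover have "\<forall>p\<in>I \<times> J - K \<times> L. (case p of (i, j) \<Rightarrow> f i * g j) $ n = 0"
  proof
    fix p assume p: "p \<in> I \<times> J - K \<times> L"
    obtain i j where ij: "p = (i, j)" "i \<in> I" "j \<in> J" "(i, j) \<notin> K \<times> L"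
      using p by (cases p) auto
    have "f i $ k * g j $ (n - k) = 0" if "k \<in> {0..n}" for k
      using f0[of i k] g0[of j "n - k"] ij that by (cases "i \<in> K") auto
    then show "(case p of (i, j) \<Rightarrow> f i * g j) $ n = 0"
      unfolding ij(1) by (auto simp: fps_mult_nth intro!: sum.neutral)
  qed
  ultimately show "\<exists>M\<subseteq>I \<times> J. finite M \<and> (\<forall>p\<in>I \<times> J - M. (case p of (i, j) \<Rightarrow> f i * g j) $ n = 0)
      \<and> (S * T) $ n = (\<Sum>p\<in>M. (case p of (i, j) \<Rightarrow> f i * g j) $ n)"
    using KL by (intro exI[of _ "K \<times> L"]) auto
qed

lemma has_formal_sum_cmult:
  fixes f :: "'i \<Rightarrow> 'a::comm_semiring_1 fps"
  assumes "has_formal_sum f I S"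
  shows "has_formal_sum (\<lambda>i. c * f i) I (c * S)"
proof -
  have "has_formal_sum (\<lambda>(i, j). c * f j) ({()} \<times> I) (c * S)"
    using has_formal_sum_prod[OF has_formal_sum_singleton[of "\<lambda>_. c" "()"] assms] .
  then have "has_formal_sum (\<lambda>p. c * f (snd p)) ({()} \<times> I) (c * S)"
    by (simp add: case_prod_unfold)
  then have "has_formal_sum (\<lambda>i. c * f i) (snd ` ({()} \<times> I)) (c * S)"
    by (rule has_formal_sum_reindex[rotated]) (auto simp: inj_on_def)
  then show ?thesis by simp
qed

text \<open>Fubini for a partition of the index set into fibres.  Fibres may be infinite, but for a fixed
  coefficient only finitely many terms, and hence finitely many fibres, matter.\<close>
lemma has_formal_sum_fibres:
  assumes f: "has_formal_sum f I S" and h: "\<And>i. i \<in> I \<Longrightarrow> h i \<in> A"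
    and g: "\<And>a. a \<in> A \<Longrightarrow> has_formal_sum f {i \<in> I. h i = a} (g a)"
  shows "has_formal_sum g A S"
  unfolding has_formal_sum_def
proof
  fix n
  obtain J where J: "J \<subseteq> I" "finite J" "\<forall>i\<in>I - J. f i $ n = 0" "S $ n = (\<Sum>i\<in>J. f i $ n)"
    using f unfolding has_formal_sum_def by blast
  have gn: "g a $ n = (\<Sum>i | i \<in> J \<and> h i = a. f i $ n)" if "a \<in> A" for a
    by (rule has_formal_sum_nth[OF g[OF that]]) (use J in auto)
  have "(\<Sum>a\<in>h ` J. g a $ n) = (\<Sum>a\<in>h ` J. \<Sum>i | i \<in> J \<and> h i = a. f i $ n)"
    using J h by (intro sum.cong refl gn) auto
  also have "\<dots> = S $ n"
    using J by (simp add: sum.group)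
  finally have "S $ n = (\<Sum>a\<in>h ` J. g a $ n)" by simp
  moreover have "g a $ n = 0" if "a \<in> A - h ` J" for a
  proof -
    have "{i. i \<in> J \<and> h i = a} = {}" using that by auto
    then show ?thesis using gn[of a] that by (simp only: sum.empty) auto
  qed
  ultimately show "\<exists>B\<subseteq>A. finite B \<and> (\<forall>a\<in>A - B. g a $ n = 0) \<and> S $ n = (\<Sum>a\<in>B. g a $ n)"
    using J h by (intro exI[of _ "h ` J"]) auto
qed

lemma has_formal_sum_sum:
  assumes "finite D" "\<And>d. d \<in> D \<Longrightarrow> has_formal_sum (f d) I (S d)"
  shows "has_formal_sum (\<lambda>i. \<Sum>d\<in>D. f d i) I (\<Sum>d\<in>D. S d)"
  unfolding has_formal_sum_def
proof
  fix n
  have "\<exists>J\<subseteq>I. finite J \<and> (\<forall>i\<in>I - J. f d i $ n = 0)" if "d \<in> D" for d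
    using assms(2)[OF that] unfolding has_formal_sum_def by blast
  then obtain J where J: "\<And>d. d \<in> D \<Longrightarrow> J d \<subseteq> I" "\<And>d. d \<in> D \<Longrightarrow> finite (J d)"
    "\<And>d i. d \<in> D \<Longrightarrow> i \<in> I - J d \<Longrightarrow> f d i $ n = 0"
    by metis
  define K where "K = (\<Union>d\<in>D. J d)"
  have "(\<Sum>d\<in>D. S d) $ n = (\<Sum>d\<in>D. \<Sum>i\<in>K. f d i $ n)"
    unfolding fps_sum_nth
    by (intro sum.cong refl has_formal_sum_nth[OF assms(2)]) (use J assms(1) in \<open>auto simp: K_def\<close>)
  also have "\<dots> = (\<Sum>i\<in>K. (\<Sum>d\<in>D. f d i) $ n)"
    unfolding fps_sum_nth by (rule sum.swap)
  finally show "\<exists>K\<subseteq>I. finite K \<and> (\<forall>i\<in>I - K. (\<Sum>d\<in>D. f d i) $ n = 0)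
      \<and> (\<Sum>d\<in>D. S d) $ n = (\<Sum>i\<in>K. (\<Sum>d\<in>D. f d i) $ n)"
    using J assms(1) by (intro exI[of _ K]) (auto simp: K_def fps_sum_nth intro!: sum.neutral)
qed

text \<open>Sums of series in \<open>y\<close> whose coefficients are series in \<open>X\<close>.  Infinitely many trees contribute
  to a fixed power of \<open>y\<close>, so finiteness is only available for fixed powers of both variables.\<close>
definition has_double_sum :: "('i \<Rightarrow> 'a::comm_monoid_add fps fps) \<Rightarrow> 'i set \<Rightarrow> 'a fps fps \<Rightarrow> bool" where
  "has_double_sum f I S \<longleftrightarrow> (\<forall>d. has_formal_sum (\<lambda>i. f i $ d) I (S $ d))"

lemma has_double_sum_unique:
  "has_double_sum f I S \<Longrightarrow> has_double_sum f I T \<Longrightarrow> S = T"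
  unfolding has_double_sum_def by (metis fps_ext has_formal_sum_unique)

lemma has_double_sum_singleton: "has_double_sum f {i} (f i)"
  unfolding has_double_sum_def using has_formal_sum_singleton[of "\<lambda>i. f i $ _"] by simp

lemma has_double_sum_union:
  assumes "has_double_sum f I S" "has_double_sum f J T" "I \<inter> J = {}"
  shows "has_double_sum f (I \<union> J) (S + T)"
  using assms has_formal_sum_union unfolding has_double_sum_def by (metis fps_add_nth)

lemma has_double_sum_reindex:
  assumes "inj_on h I" "has_double_sum (\<lambda>i. f (h i)) I S"
  shows "has_double_sum f (h ` I) S"
  using assms unfolding has_double_sum_def by (auto intro: has_formal_sum_reindex)

lemma has_double_sum_cong:
  assumes "\<And>i. i \<in> I \<Longrightarrow> f i = g i" "has_double_sum f I S"
  shows "has_double_sum g I S"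
  using assms has_formal_sum_cong[of I "\<lambda>i. f i $ _" "\<lambda>i. g i $ _"]
  unfolding has_double_sum_def by auto

lemma has_double_sum_prod:
  fixes f :: "'i \<Rightarrow> 'a::comm_semiring_1 fps fps"
  assumes "has_double_sum f I S" "has_double_sum g J T"
  shows "has_double_sum (\<lambda>(i, j). f i * g j) (I \<times> J) (S * T)"
  unfolding has_double_sum_def
proof
  fix d
  have "has_formal_sum (\<lambda>p. \<Sum>e=0..d. case p of (i, j) \<Rightarrow> f i $ e * g j $ (d - e)) (I \<times> J)
      (\<Sum>e=0..d. S $ e * T $ (d - e))"
    using assms unfolding has_double_sum_def
    by (intro has_formal_sum_sum has_formal_sum_prod) auto
  then show "has_formal_sum (\<lambda>p. (case p of (i, j) \<Rightarrow> f i * g j) $ d) (I \<times> J) ((S * T) $ d)"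
    by (simp add: fps_mult_nth case_prod_unfold)
qed

lemma has_double_sum_fun_upd:
  fixes f :: "'i \<Rightarrow> 'a::ab_group_add fps fps"
  assumes "has_double_sum f I S" "a \<in> I"
  shows "has_double_sum (f(a := b)) I (S - f a + b)"
  unfolding has_double_sum_def
proof
  fix d
  have "(\<lambda>i. (f(a := b)) i $ d) = (\<lambda>i. f i $ d)(a := b $ d)" by auto
  then show "has_formal_sum (\<lambda>i. (f(a := b)) i $ d) I ((S - f a + b) $ d)"
    using assms has_formal_sum_fun_upd[of "\<lambda>i. f i $ d" I "S $ d" a "b $ d"]
    by (simp add: has_double_sum_def)
qed

lemma has_double_sum_cmult:
  fixes f :: "'i \<Rightarrow> 'a::comm_semiring_1 fps fps"
  assumes "has_double_sum f I S"
  shows "has_double_sum (\<lambda>i. c * f i) I (c * S)"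
proof -
  have "has_double_sum (\<lambda>(i, j). c * f j) ({()} \<times> I) (c * S)"
    using has_double_sum_prod[OF has_double_sum_singleton[of "\<lambda>_. c" "()"] assms] .
  then have "has_double_sum (\<lambda>p. c * f (snd p)) ({()} \<times> I) (c * S)"
    by (simp add: case_prod_unfold)
  then have "has_double_sum (\<lambda>i. c * f i) (snd ` ({()} \<times> I)) (c * S)"
    by (rule has_double_sum_reindex[rotated]) (auto simp: inj_on_def)
  then show ?thesis by simp
qed

section \<open>Counting nodes and old leaves\<close>

text \<open>The variable \<open>t\<close> marks the old leaves, i.e. the leaves that are leftmost children, and \<open>z\<close> all
  other nodes.  The root is never an old leaf, so a tree that is placed as a first child
  contributes \<open>first_weight\<close> instead of \<open>weight\<close>.\<close>
fun weight :: "'a::comm_semiring_1 \<Rightarrow> 'a \<Rightarrow> plane_tree \<Rightarrow> 'a" where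
  "weight z t (Node []) = z"
| "weight z t (Node (c # cs)) =
     z * (if c = Node [] then t else weight z t c) * (\<Prod>c'\<leftarrow>cs. weight z t c')"

definition first_weight :: "'a::comm_semiring_1 \<Rightarrow> 'a \<Rightarrow> plane_tree \<Rightarrow> 'a" where
  "first_weight z t c = (if c = Node [] then t else weight z t c)"

abbreviation forest_weight :: "'a::comm_semiring_1 \<Rightarrow> 'a \<Rightarrow> plane_tree list \<Rightarrow> 'a" where
  "forest_weight z t cs \<equiv> (\<Prod>c\<leftarrow>cs. weight z t c)"

lemma weight_Cons: "weight z t (Node (c # cs)) = z * (first_weight z t c * forest_weight z t cs)"
  by (simp add: first_weight_def mult.assoc)

lemma first_weight_eq_fun_upd: "first_weight z t = (weight z t)(Node [] := t)"
  by (auto simp: first_weight_def)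

declare weight.simps(2) [simp del]

lemma plane_tree_induct [case_names leaf node]:
  assumes "P (Node [])"
    and "\<And>c cs. P c \<Longrightarrow> (\<And>t. t \<in> set cs \<Longrightarrow> P t) \<Longrightarrow> P (Node (c # cs))"
  shows "P \<tau>"
proof (induction \<tau>)
  case (Node ts)
  then show ?case by (cases ts) (auto intro: assms)
qed

lemma weight_diagonal: "weight x x \<tau> = x ^ nodes \<tau>"
proof (induction \<tau> rule: plane_tree_induct)
  case (node c cs)
  have "forest_weight x x cs = x ^ (\<Sum>t\<leftarrow>cs. nodes t)"
    using node(2) by (induction cs) (auto simp: power_add)
  moreover have "first_weight x x c = x ^ nodes c"
    using node(1) by (auto simp: first_weight_def)
  ultimately show ?case
    by (simp add: weight_Cons power_add)
qed simp

text \<open>Scaling both variables marks the size of the tree.\<close>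
lemma weight_scale: "weight (x * z) (x * t) \<tau> = x ^ nodes \<tau> * weight z t \<tau>"
proof (induction \<tau> rule: plane_tree_induct)
  case (node c cs)
  have "forest_weight (x * z) (x * t) cs = x ^ (\<Sum>t\<leftarrow>cs. nodes t) * forest_weight z t cs"
    using node(2) by (induction cs) (auto simp: power_add ac_simps)
  moreover have "first_weight (x * z) (x * t) c = x ^ nodes c * first_weight z t c"
    using node(1) by (auto simp: first_weight_def)
  ultimately show ?case
    by (simp add: weight_Cons power_add ac_simps)
qed simp

lemma weight_fps_const:
  "weight (fps_const z) (fps_const t) \<tau> = fps_const (weight z t \<tau>)"
proof (induction \<tau> rule: plane_tree_induct)
  case (node c cs)
  have "forest_weight (fps_const z) (fps_const t) cs = fps_const (forest_weight z t cs)"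
    using node(2) by (induction cs) auto
  moreover have "first_weight (fps_const z) (fps_const t) c = fps_const (first_weight z t c)"
    using node(1) by (auto simp: first_weight_def)
  ultimately show ?case
    by (simp add: weight_Cons)
qed simp

lemma power_nodes_dvd_weight:
  fixes x :: "'a::comm_semiring_1"
  assumes "x dvd z" "x dvd t"
  shows "x ^ nodes \<tau> dvd weight z t \<tau>"
proof -
  obtain z' t' where "z = x * z'" "t = x * t'" using assms by (auto elim!: dvdE)
  then show ?thesis by (simp add: weight_scale)
qed

lemma fps_nth_eq_0_of_dvd:
  fixes f :: "'a::comm_ring_1 fps"
  assumes "fps_X ^ k dvd f" "n < k"
  shows "f $ n = 0"
  using assms by (auto elim!: dvdE simp: fps_X_power_mult_nth)

lemma fps_X_dvd_iff_nth_0: "fps_X dvd f \<longleftrightarrow> f $ 0 = (0 :: 'a::comm_ring_1)"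
proof
  assume "f $ 0 = 0"
  then have "f = fps_X * fps_shift 1 f"
    by (intro fps_ext) (auto simp: gr0_conv_Suc split: nat.splits)
  then show "fps_X dvd f" by (rule dvdI)
next
  assume "fps_X dvd f"
  then show "f $ 0 = 0" by (auto elim!: dvdE)
qed

lemma weights_summable:
  fixes z t :: "'a::comm_ring_1 fps"
  assumes "z $ 0 = 0" "t $ 0 = 0"
    and f: "\<And>\<tau>. \<tau> \<in> I \<Longrightarrow> weight z t \<tau> dvd f \<tau>"
  shows "\<exists>S. has_formal_sum f I S"
proof (rule has_formal_sum_exists)
  fix n
  have "nodes \<tau> \<le> n" if "\<tau> \<in> I" "f \<tau> $ n \<noteq> 0" for \<tau>
  proof (rule ccontr)
    assume "\<not> nodes \<tau> \<le> n"
    moreover have "fps_X ^ nodes \<tau> dvd f \<tau>"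
      using assms(1,2)
      by (intro dvd_trans[OF power_nodes_dvd_weight f[OF that(1)]]) (simp_all add: fps_X_dvd_iff_nth_0)
    ultimately show False using fps_nth_eq_0_of_dvd[of "nodes \<tau>" "f \<tau>" n] that(2) by simp
  qed
  then show "finite {\<tau> \<in> I. f \<tau> $ n \<noteq> 0}"
    by (intro finite_subset[OF _ finite_plane_trees_le[of n]]) auto
qed

lemma rho_eq_leaf_iff: "rho \<tau> = Node [] \<longleftrightarrow> is_path \<tau>"
  by (cases \<tau> rule: rho.cases) auto

text \<open>The recursion for paths behind the geometric series \<open>t + z t + z\<^sup>2 t + \<dots>\<close>.\<close>
lemma paths_eq: "{p. is_path p} = {Node []} \<union> (\<lambda>p. Node [p]) ` {p. is_path p}"
proof (intro set_eqI iffI)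
  fix p assume "p \<in> {p. is_path p}"
  then show "p \<in> {Node []} \<union> (\<lambda>p. Node [p]) ` {p. is_path p}"
    by (cases p rule: rho.cases) (auto simp: image_iff)
qed auto

text \<open>The total weight \<open>q = t / (1 - z)\<close> of the old paths that can be attached to a node, determined
  as the solution of \<open>S = t + z S\<close>.\<close>
lemma has_formal_sum_first_weight_paths:
  fixes z t q :: "'a::idom fps"
  assumes zt: "z $ 0 = 0" "t $ 0 = 0" and q: "q * (1 - z) = t"
  shows "has_formal_sum (first_weight z t) {p. is_path p} q"
proof -
  obtain W where "has_formal_sum (weight z t) {p. is_path p} W"
    using weights_summable[OF zt, of "{p. is_path p}" "weight z t"] by auto
  then have "has_formal_sum ((weight z t)(Node [] := t)) {p. is_path p} (W - weight z t (Node []) + t)"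
    by (rule has_formal_sum_fun_upd) simp
  then obtain S where S: "has_formal_sum (first_weight z t) {p. is_path p} S"
    by (simp add: first_weight_eq_fun_upd)
  have "has_formal_sum (\<lambda>p. z * first_weight z t p) {p. is_path p} (z * S)"
    by (rule has_formal_sum_cmult[OF S])
  then have "has_formal_sum (\<lambda>p. first_weight z t (Node [p])) {p. is_path p} (z * S)"
    by (rule has_formal_sum_cong[rotated]) (simp add: weight_Cons first_weight_def[of z t "Node [_]"])
  then have "has_formal_sum (first_weight z t) ((\<lambda>p. Node [p]) ` {p. is_path p}) (z * S)"
    by (rule has_formal_sum_reindex[rotated]) (auto simp: inj_on_def)
  moreover have "has_formal_sum (first_weight z t) {Node []} t"
    using has_formal_sum_singleton[of "first_weight z t" "Node []"] by (simp add: first_weight_def)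
  ultimately have "has_formal_sum (first_weight z t) {p. is_path p} (t + z * S)"
    by (subst paths_eq) (rule has_formal_sum_union, auto)
  then have S_eq: "S = t + z * S"
    by (rule has_formal_sum_unique[OF S])
  have "S * (1 - z) = S - z * S"
    by (simp add: algebra_simps)
  also have "\<dots> = t"
    by (subst S_eq) simp
  finally have "S * (1 - z) = q * (1 - z)"
    using q by simp
  moreover have "1 - z \<noteq> 0"
    using zt by auto
  ultimately show ?thesis using S by simp
qed

lemma has_formal_sum_forest_fibre:
  fixes z t z' t' :: "'a::comm_ring_1 fps"
  assumes "\<And>s. s \<in> set ss \<Longrightarrow> has_formal_sum (weight z t) {\<tau>. rho \<tau> = s} (weight z' t' s)"
  shows "has_formal_sum (forest_weight z t) {ts. map rho ts = ss} (forest_weight z' t' ss)"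
  using assms
proof (induction ss)
  case Nil
  have "{ts. map rho ts = []} = {[]}" by auto
  then show ?case using has_formal_sum_singleton[of "forest_weight z t" "[]"] by simp
next
  case (Cons s ss)
  have eq: "{ts. map rho ts = s # ss} = (\<lambda>(t, ts). t # ts) ` ({\<tau>. rho \<tau> = s} \<times> {ts. map rho ts = ss})"
    by (auto simp: map_eq_Cons_conv image_iff)
  have "has_formal_sum (\<lambda>(\<tau>, ts). weight z t \<tau> * forest_weight z t ts)
      ({\<tau>. rho \<tau> = s} \<times> {ts. map rho ts = ss}) (weight z' t' s * forest_weight z' t' ss)"
    using Cons by (intro has_formal_sum_prod) auto
  then show ?case
    unfolding eq by (intro has_formal_sum_reindex) (auto simp: inj_on_def case_prod_unfold)
qed

text \<open>Either a path was cut in front of the surviving children, or nothing was cut; in the latter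
  case the first child was not a path, so what remains of it is more than a single node.\<close>
lemma rho_fibre_Node:
  "{\<tau>. rho \<tau> = Node (s # ss)} =
     (\<lambda>(t, ts). Node (t # ts)) ` ({p. is_path p} \<times> {ts. map rho ts = s # ss}) \<union>
     (\<lambda>(t, ts). Node (t # ts)) ` ((if s = Node [] then {} else {\<tau>. rho \<tau> = s}) \<times> {ts. map rho ts = ss})"
  (is "?L = ?P \<union> ?R")
proof (intro set_eqI iffI)
  fix \<tau> assume "\<tau> \<in> ?L"
  then show "\<tau> \<in> ?P \<union> ?R"
    by (cases \<tau> rule: rho.cases) (auto simp: rho_eq_leaf_iff[symmetric] image_iff split: if_splits)
next
  fix \<tau> assume "\<tau> \<in> ?P \<union> ?R"
  then show "\<tau> \<in> ?L"
    by (auto simp: rho_eq_leaf_iff[symmetric] split: if_splits)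
qed

text \<open>Undoing one cut.  At a node whose first child is not a leaf, the options path and no path give
  the factor \<open>z (1 + q)\<close>.  At a node whose first child is a leaf, only \<open>z q\<close> is available, whereas
  the leaf itself expands to \<open>z (1 + q)\<close>; exchanging these two factors attributes \<open>z q\<close> to the old
  leaf and \<open>z (1 + q)\<close> to every other node.\<close>
lemma has_formal_sum_rho_fibre:
  fixes z t q :: "'a::idom fps"
  assumes zt: "z $ 0 = 0" "t $ 0 = 0" and q: "q * (1 - z) = t"
  shows "has_formal_sum (weight z t) {\<tau>. rho \<tau> = \<sigma>} (weight (z * (1 + q)) (z * q) \<sigma>)"
proof (induction \<sigma> rule: plane_tree_induct)
  note paths = has_formal_sum_first_weight_paths[OF assms]
  case leaf
  have "has_formal_sum (\<lambda>p. z * first_weight z t p) {p. is_path p} (z * q)"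
    by (rule has_formal_sum_cmult[OF paths])
  then have "has_formal_sum (\<lambda>p. weight z t (Node [p])) {p. is_path p} (z * q)"
    by (rule has_formal_sum_cong[rotated]) (simp add: weight_Cons)
  then have "has_formal_sum (weight z t) ((\<lambda>p. Node [p]) ` {p. is_path p}) (z * q)"
    by (rule has_formal_sum_reindex[rotated]) (auto simp: inj_on_def)
  then have "has_formal_sum (weight z t) {p. is_path p} (weight z t (Node []) + z * q)"
    by (subst paths_eq) (rule has_formal_sum_union[OF has_formal_sum_singleton], auto)
  then show ?case by (simp add: rho_eq_leaf_iff distrib_left)
next
  note paths = has_formal_sum_first_weight_paths[OF assms]
  case (node s ss)
  define z' t' where "z' = z * (1 + q)" and "t' = z * q"
  note IH = node[folded z'_def t'_def]
  let ?Cons = "\<lambda>(t, ts). Node (t # ts)"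
  have attach: "has_formal_sum (weight z t) (?Cons ` (A \<times> B)) (z * (S * T))"
    if "has_formal_sum (first_weight z t) A S" "has_formal_sum (forest_weight z t) B T" for A B S T
  proof (rule has_formal_sum_reindex)
    have "has_formal_sum (\<lambda>p. z * (case p of (\<tau>, ts) \<Rightarrow> first_weight z t \<tau> * forest_weight z t ts))
        (A \<times> B) (z * (S * T))"
      using that by (intro has_formal_sum_cmult has_formal_sum_prod)
    then show "has_formal_sum (\<lambda>p. weight z t (?Cons p)) (A \<times> B) (z * (S * T))"
      by (rule has_formal_sum_cong[rotated]) (auto simp: weight_Cons)
  qed (auto simp: inj_on_def)
  have forest: "has_formal_sum (forest_weight z t) {ts. map rho ts = ss} (forest_weight z' t' ss)"
    and forest': "has_formal_sum (forest_weight z t) {ts. map rho ts = s # ss}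
      (weight z' t' s * forest_weight z' t' ss)"
    using has_formal_sum_forest_fibre[of ss z t z' t'] has_formal_sum_forest_fibre[of "s # ss" z t z' t'] IH
    by auto
  define A where "A = (if s = Node [] then {} else {\<tau>. rho \<tau> = s})"
  have A: "has_formal_sum (first_weight z t) A (if s = Node [] then 0 else weight z' t' s)"
  proof (cases "s = Node []")
    case True
    then show ?thesis unfolding has_formal_sum_def A_def by auto
  next
    case False
    then have "has_formal_sum (first_weight z t) {\<tau>. rho \<tau> = s} (weight z' t' s)"
      by (intro has_formal_sum_cong[OF _ IH(1)]) (auto simp: first_weight_def)
    then show ?thesis using False by (simp add: A_def)
  qed
  have not_path: "\<not> is_path \<tau>" if "\<tau> \<in> A" for \<tau>
    using that rho_eq_leaf_iff[of \<tau>] by (cases "s = Node []") (simp_all add: A_def)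
  have disj: "?Cons ` ({p. is_path p} \<times> {ts. map rho ts = s # ss}) \<inter> ?Cons ` (A \<times> {ts. map rho ts = ss}) = {}"
    by (auto dest: not_path)
  have "has_formal_sum (weight z t) {\<tau>. rho \<tau> = Node (s # ss)}
      (z * (q * (weight z' t' s * forest_weight z' t' ss)) +
       z * ((if s = Node [] then 0 else weight z' t' s) * forest_weight z' t' ss))"
    unfolding rho_fibre_Node A_def[symmetric]
    by (rule has_formal_sum_union[OF attach[OF paths forest'] attach[OF A forest] disj])
  also have "z * (q * (weight z' t' s * forest_weight z' t' ss)) +
       z * ((if s = Node [] then 0 else weight z' t' s) * forest_weight z' t' ss)
      = weight z' t' (Node (s # ss))"
    by (simp add: weight_Cons first_weight_def z'_def t'_def algebra_simps)
  finally show ?case by (simp add: z'_def t'_def)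
qed

section \<open>Iterated cutting\<close>

text \<open>The trees that become \<open>\<sigma>\<close> after \<open>r + 1\<close> cuts are grouped by what they are after \<open>r\<close> cuts.\<close>
lemma has_formal_sum_iterated_rho_fibre:
  fixes z t q :: "nat \<Rightarrow> 'a::idom fps"
  assumes zt: "\<And>r. z r $ 0 = 0" "\<And>r. t r $ 0 = 0"
    and q: "\<And>r. q r * (1 - z r) = t r"
    and Suc: "\<And>r. z (Suc r) = z r * (1 + q r)" "\<And>r. t (Suc r) = z r * q r"
  shows "has_formal_sum (weight (z 0) (t 0)) {\<tau>. (rho ^^ r) \<tau> = \<sigma>} (weight (z r) (t r) \<sigma>)"
proof (induction r arbitrary: \<sigma>)
  case 0
  then show ?case
    using has_formal_sum_singleton[of "weight (z 0) (t 0)" \<sigma>] by simp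
next
  case (Suc r)
  let ?C = "{\<tau>. (rho ^^ Suc r) \<tau> = \<sigma>}"
  obtain S where S: "has_formal_sum (weight (z 0) (t 0)) ?C S"
    using weights_summable[OF zt(1)[of 0] zt(2)[of 0], of ?C "weight (z 0) (t 0)"] by auto
  have "has_formal_sum (weight (z r) (t r)) {\<sigma>'. rho \<sigma>' = \<sigma>} S"
  proof (rule has_formal_sum_fibres[OF S, where h = "rho ^^ r"])
    fix \<sigma>' assume "\<sigma>' \<in> {\<sigma>'. rho \<sigma>' = \<sigma>}"
    then have "{\<tau> \<in> ?C. (rho ^^ r) \<tau> = \<sigma>'} = {\<tau>. (rho ^^ r) \<tau> = \<sigma>'}" by auto
    then show "has_formal_sum (weight (z 0) (t 0)) {\<tau> \<in> ?C. (rho ^^ r) \<tau> = \<sigma>'} (weight (z r) (t r) \<sigma>')"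
      using Suc.IH by simp
  qed simp
  moreover have "has_formal_sum (weight (z r) (t r)) {\<sigma>'. rho \<sigma>' = \<sigma>} (weight (z (Suc r)) (t (Suc r)) \<sigma>)"
    using has_formal_sum_rho_fibre[OF zt(1)[of r] zt(2)[of r] q] by (simp only: assms(4,5))
  ultimately show ?case
    using S has_formal_sum_unique by metis
qed

text \<open>Since \<open>weight fps_X fps_X \<tau>\<close> is \<open>X\<close> to the size of \<open>\<tau>\<close>, the coefficients of a sum over all
  trees are sums over the trees of fixed size; summing over the fibres of \<open>rho ^^ r\<close> first
  expresses them through the trees that remain.\<close>
lemma sum_plane_trees:
  assumes E: "\<And>\<sigma>. has_formal_sum (weight fps_X fps_X) {\<tau>. (rho ^^ r) \<tau> = \<sigma>} (F \<sigma>)"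
    and S: "has_formal_sum (\<lambda>\<sigma>. fps_const (c \<sigma>) * F \<sigma>) UNIV S"
  shows "(\<Sum>\<tau>\<in>plane_trees n. c ((rho ^^ r) \<tau>)) = (S $ n :: real)"
proof -
  let ?f = "\<lambda>\<tau>. fps_const (c ((rho ^^ r) \<tau>)) * weight fps_X fps_X \<tau>"
  have "\<exists>T. has_formal_sum ?f UNIV T"
    by (rule weights_summable[of fps_X fps_X]) auto
  then obtain T where T: "has_formal_sum ?f UNIV T" ..
  have "has_formal_sum (\<lambda>\<sigma>. fps_const (c \<sigma>) * F \<sigma>) UNIV T"
  proof (rule has_formal_sum_fibres[OF T, where h = "rho ^^ r"])
    fix \<sigma>
    have "has_formal_sum ?f {\<tau>. (rho ^^ r) \<tau> = \<sigma>} (fps_const (c \<sigma>) * F \<sigma>)"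
      by (rule has_formal_sum_cong[OF _ has_formal_sum_cmult[OF E]]) simp
    then show "has_formal_sum ?f {\<tau> \<in> UNIV. (rho ^^ r) \<tau> = \<sigma>} (fps_const (c \<sigma>) * F \<sigma>)" by simp
  qed simp
  then have "T = S" using S has_formal_sum_unique by blast
  moreover have "T $ n = (\<Sum>\<tau>\<in>plane_trees n. ?f \<tau> $ n)"
    by (rule has_formal_sum_nth[OF T finite_plane_trees])
       (auto simp: plane_trees_def weight_diagonal fps_X_power_nth)
  ultimately show ?thesis
    by (simp add: plane_trees_def weight_diagonal fps_X_power_nth)
qed

section \<open>The generating function of plane trees by nodes and old leaves\<close>

text \<open>The lists of children are counted by \<open>L = 1 / (1 - G)\<close>, and a tree with more than one node is a
  root, a first child (a leaf weighs \<open>t\<close> instead of \<open>z\<close> there) and a list of further children: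
  \<open>G = z + z (G - z + t) L\<close>.\<close>
lemma weight_sum_functional_equation:
  fixes z t G L :: "'a::comm_ring_1 fps fps"
  assumes G: "has_double_sum (weight z t) UNIV G"
    and L: "has_double_sum (forest_weight z t) UNIV L"
  shows "G\<^sup>2 - G + z + z * t - z\<^sup>2 = 0"
proof -
  let ?Cons = "\<lambda>(c, cs). c # cs"
  have lists: "UNIV = {[]} \<union> ?Cons ` (UNIV \<times> (UNIV :: plane_tree list set))"
  proof (intro set_eqI iffI)
    fix ts :: "plane_tree list"
    show "ts \<in> {[]} \<union> ?Cons ` (UNIV \<times> UNIV)" by (cases ts) auto
  qed simp
  have trees: "UNIV = {Node []} \<union> (\<lambda>(c, cs). Node (c # cs)) ` (UNIV \<times> (UNIV :: plane_tree list set))"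
  proof (intro set_eqI iffI)
    fix \<tau> :: plane_tree
    show "\<tau> \<in> {Node []} \<union> (\<lambda>(c, cs). Node (c # cs)) ` (UNIV \<times> UNIV)"
      by (cases \<tau> rule: rho.cases) auto
  qed simp
  have "has_double_sum (\<lambda>p. forest_weight z t (?Cons p)) (UNIV \<times> UNIV) (G * L)"
    by (rule has_double_sum_cong[OF _ has_double_sum_prod[OF G L]]) auto
  then have "has_double_sum (forest_weight z t) (?Cons ` (UNIV \<times> UNIV)) (G * L)"
    by (rule has_double_sum_reindex[rotated]) (auto simp: inj_on_def)
  moreover have "has_double_sum (forest_weight z t) {[]} 1"
    using has_double_sum_singleton[of "forest_weight z t" "[]"] by simp
  ultimately have "has_double_sum (forest_weight z t) UNIV (1 + G * L)"
    by (subst lists) (rule has_double_sum_union, auto)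
  then have L_eq: "L = 1 + G * L"
    by (rule has_double_sum_unique[OF L])
  have fw: "has_double_sum (first_weight z t) UNIV (G - z + t)"
    using has_double_sum_fun_upd[OF G, of "Node []" t] by (simp add: first_weight_eq_fun_upd)
  have "has_double_sum (\<lambda>p. z * (case p of (c, cs) \<Rightarrow> first_weight z t c * forest_weight z t cs))
      (UNIV \<times> UNIV) (z * ((G - z + t) * L))"
    by (rule has_double_sum_cmult[OF has_double_sum_prod[OF fw L]])
  then have "has_double_sum (\<lambda>p. weight z t (case p of (c, cs) \<Rightarrow> Node (c # cs))) (UNIV \<times> UNIV)
      (z * ((G - z + t) * L))"
    by (rule has_double_sum_cong[rotated]) (auto simp: weight_Cons)
  then have "has_double_sum (weight z t) ((\<lambda>(c, cs). Node (c # cs)) ` (UNIV \<times> UNIV)) (z * ((G - z + t) * L))"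
    by (rule has_double_sum_reindex[rotated]) (auto simp: inj_on_def)
  moreover have "has_double_sum (weight z t) {Node []} z"
    using has_double_sum_singleton[of "weight z t" "Node []"] by simp
  ultimately have "has_double_sum (weight z t) UNIV (z + z * ((G - z + t) * L))"
    by (subst trees) (rule has_double_sum_union, auto)
  then have "G = z + z * ((G - z + t) * L)"
    by (rule has_double_sum_unique[OF G])
  then have "G - z = z * ((G - z + t) * L)"
    by (metis add_diff_cancel_left')
  then have "(G - z) * (1 - G) = z * ((G - z + t) * L) * (1 - G)"
    by (rule arg_cong)
  also have "\<dots> = z * (G - z + t) * (L - G * L)"
    by (simp add: algebra_simps)
  also have "L - G * L = 1"
    using L_eq by (metis add_diff_cancel_right')
  finally have "(G - z) * (1 - G) = z * (G - z + t)"
    by simp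
  moreover have "G\<^sup>2 - G + z + z * t - z\<^sup>2 = z * (G - z + t) - (G - z) * (1 - G)"
    by (simp add: algebra_simps power2_eq_square)
  ultimately show ?thesis by simp
qed

lemma forest_weight_scale:
  "forest_weight (x * z) (x * t) cs = x ^ (\<Sum>c\<leftarrow>cs. nodes c) * forest_weight z t cs"
  by (induction cs) (simp_all add: weight_scale power_add mult.assoc mult.left_commute)

lemma forest_weight_fps_const:
  "forest_weight (fps_const z) (fps_const t) cs = fps_const (forest_weight z t cs)"
  by (induction cs) (simp_all add: weight_fps_const)

lemma forest_weights_summable:
  fixes z t :: "'a::comm_ring_1 fps"
  assumes zt: "z $ 0 = 0" "t $ 0 = 0"
    and f: "\<And>ts. forest_weight z t ts dvd f ts"
  shows "\<exists>S. has_formal_sum f UNIV S"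
proof (rule has_formal_sum_exists)
  fix n
  obtain z' t' where z': "z = fps_X * z'" and t': "t = fps_X * t'"
    using zt by (auto simp: fps_X_dvd_iff_nth_0[symmetric] elim!: dvdE)
  have "nodes (Node ts) \<le> Suc n" if "f ts $ n \<noteq> 0" for ts
  proof (rule ccontr)
    assume *: "\<not> nodes (Node ts) \<le> Suc n"
    have "fps_X ^ (\<Sum>c\<leftarrow>ts. nodes c) dvd forest_weight z t ts"
      unfolding z' t' forest_weight_scale by simp
    then have "fps_X ^ (\<Sum>c\<leftarrow>ts. nodes c) dvd f ts"
      using f by (rule dvd_trans)
    from fps_nth_eq_0_of_dvd[OF this, of n] * that show False by simp
  qed
  then have "{ts \<in> UNIV. f ts $ n \<noteq> 0} \<subseteq> Node -` {\<tau>. nodes \<tau> \<le> Suc n}" by auto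
  moreover have "finite (Node -` {\<tau>. nodes \<tau> \<le> Suc n})"
    by (rule finite_vimageI[OF finite_plane_trees_le]) (simp add: inj_on_def)
  ultimately show "finite {ts \<in> UNIV. f ts $ n \<noteq> 0}" by (rule finite_subset)
qed

text \<open>The factor \<open>y ^ nodes \<tau>\<close> is obtained by scaling both variables of the weight by \<open>y\<close>.\<close>
lemma size_marked_sum:
  fixes z t :: "'a::comm_ring_1 fps" and y :: "'a fps fps"
  assumes zt: "z $ 0 = 0" "t $ 0 = 0"
  shows "\<exists>G. (\<forall>d. has_formal_sum (\<lambda>\<tau>. (y ^ nodes \<tau>) $ d * weight z t \<tau>) UNIV (G $ d)) \<and>
    G\<^sup>2 - G + y * fps_const z - y\<^sup>2 * fps_const (z * (z - t)) = 0"
proof -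
  let ?z = "y * fps_const z" and ?t = "y * fps_const t"
  have weight: "weight ?z ?t \<tau> $ d = (y ^ nodes \<tau>) $ d * weight z t \<tau>" for \<tau> d
    by (simp add: weight_scale weight_fps_const)
  have forest: "forest_weight ?z ?t ts $ d = (y ^ (\<Sum>c\<leftarrow>ts. nodes c)) $ d * forest_weight z t ts" for ts d
    by (simp add: forest_weight_scale forest_weight_fps_const)
  have "\<exists>S. has_formal_sum (\<lambda>\<tau>. weight ?z ?t \<tau> $ d) UNIV S" for d
    by (rule weights_summable[OF zt]) (simp add: weight)
  then obtain g where g: "\<And>d. has_formal_sum (\<lambda>\<tau>. weight ?z ?t \<tau> $ d) UNIV (g d)" by metis
  have "\<exists>S. has_formal_sum (\<lambda>ts. forest_weight ?z ?t ts $ d) UNIV S" for d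
    by (rule forest_weights_summable[OF zt]) (simp add: forest)
  then obtain l where l: "\<And>d. has_formal_sum (\<lambda>ts. forest_weight ?z ?t ts $ d) UNIV (l d)" by metis
  have "(Abs_fps g)\<^sup>2 - Abs_fps g + ?z + ?z * ?t - ?z\<^sup>2 = 0"
    by (rule weight_sum_functional_equation[where L = "Abs_fps l"]) (simp_all add: has_double_sum_def g l)
  moreover have "y\<^sup>2 * fps_const (z * (z - t)) = ?z\<^sup>2 - ?z * ?t"
    by (simp add: power2_eq_square algebra_simps flip: fps_const_mult fps_const_sub)
  then have "(Abs_fps g)\<^sup>2 - Abs_fps g + y * fps_const z - y\<^sup>2 * fps_const (z * (z - t)) =
      (Abs_fps g)\<^sup>2 - Abs_fps g + ?z + ?z * ?t - ?z\<^sup>2"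
    by simp
  ultimately have "(Abs_fps g)\<^sup>2 - Abs_fps g + y * fps_const z - y\<^sup>2 * fps_const (z * (z - t)) = 0"
    by simp
  moreover have "has_formal_sum (\<lambda>\<tau>. (y ^ nodes \<tau>) $ d * weight z t \<tau>) UNIV (Abs_fps g $ d)" for d
    using g[of d] by (simp add: weight)
  ultimately show ?thesis by blast
qed

section \<open>Lagrange inversion, Narayana polynomials and Catalan numbers\<close>

lemma fls_residue_deriv_times_inverse_power:
  fixes f :: "'a::field_char_0 fls"
  shows "fls_residue (fls_deriv f * inverse f ^ Suc e) = (if e = 0 then of_int (fls_subdegree f) else 0)"
proof (cases e)
  case 0
  then show ?thesis
    using fls_residue_deriv_times_inverse_eq_subdegree(1)[of f] by simp
next
  case (Suc i)
  have "fls_deriv (inverse f ^ Suc i) = - (of_nat (Suc i) * (fls_deriv f * inverse f ^ Suc (Suc i)))"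
    unfolding fls_deriv_power fls_inverse_deriv by (simp add: power2_eq_square)
  then have "fls_residue (of_nat (Suc i) * (fls_deriv f * inverse f ^ Suc (Suc i))) = 0"
    using fls_residue_deriv[of "inverse f ^ Suc i"] by simp
  then have "of_nat (Suc i) * fls_residue (fls_deriv f * inverse f ^ Suc (Suc i)) = 0"
    unfolding fls_of_nat fls_residue_fls_const_times .
  then show ?thesis using Suc by (simp del: of_nat_Suc power_Suc)
qed

text \<open>The residue proof: \<open>m\<close> times the coefficient of \<open>X\<^sup>m\<close> in \<open>K\<close> is the residue of \<open>K' X\<^sup>-\<^sup>m\<close>, and
  \<open>X\<^sup>-\<^sup>m = \<phi>(K)\<^sup>m K\<^sup>-\<^sup>m\<close>.  Expanding \<open>\<phi>\<^sup>m\<close> leaves residues of \<open>K' K\<^sup>j\<^sup>-\<^sup>m\<close>, and of these only the one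
  with \<open>j = m - 1\<close>, a logarithmic derivative, does not vanish.\<close>
lemma lagrange_inversion:
  fixes K \<phi> :: "'a::field_char_0 fps"
  assumes K: "K = fps_X * (\<phi> oo K)" and \<phi>: "\<phi> $ 0 \<noteq> 0" and m: "m \<ge> 1"
  shows "of_nat m * K $ m = (\<phi> ^ m) $ (m - 1)"
proof -
  define f where "f = fps_to_fls K"
  define x where "x = inverse f"
  have K0: "K $ 0 = 0" by (subst K) simp
  have K1: "K $ 1 \<noteq> 0" by (subst K) (use \<phi> in simp)
  have sub: "subdegree K = 1"
    by (rule subdegreeI) (use K0 K1 in auto)
  have f_nz: "f \<noteq> 0" using K1 by (auto simp: f_def)
  then have fx: "f * x = 1" by (simp add: x_def)
  define a where "a j = (\<phi> ^ m) $ j" for j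
  \<comment> \<open>The part of \<open>\<phi>(K)\<^sup>m K\<^sup>-\<^sup>m\<close> that is a power series and hence has no influence on the residue.\<close>
  define R where "R = fps_to_fls (fps_shift m (\<phi> ^ m) oo K)"
  have "K ^ m = fps_X ^ m * (\<phi> ^ m oo K)"
    by (subst K) (simp add: power_mult_distrib fps_compose_power[OF K0])
  also have "\<phi> ^ m oo K = (\<Sum>j<m. fps_const (a j) * K ^ j) + (fps_shift m (\<phi> ^ m) oo K) * K ^ m"
  proof -
    have cutoff: "fps_cutoff m (\<phi> ^ m) = (\<Sum>j<m. fps_const (a j) * fps_X ^ j)"
      by (rule fps_ext) (simp add: fps_sum_nth a_def fps_X_power_nth if_distrib cong: if_cong)
    have "\<phi> ^ m oo K = (fps_shift m (\<phi> ^ m) * fps_X ^ m + fps_cutoff m (\<phi> ^ m)) oo K"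
      by (simp only: fps_shift_cutoff)
    also have "\<dots> = (fps_shift m (\<phi> ^ m) oo K) * K ^ m + (\<Sum>j<m. fps_const (a j) * K ^ j)"
      unfolding cutoff
      by (simp add: fps_compose_add_distrib fps_compose_mult_distrib[OF K0] fps_compose_sum_distrib
          fps_compose_power[OF K0, symmetric] K0)
    finally show ?thesis by (simp add: add.commute)
  qed
  finally have "fps_to_fls (K ^ m) = fps_to_fls (fps_X ^ m *
      ((\<Sum>j<m. fps_const (a j) * K ^ j) + (fps_shift m (\<phi> ^ m) oo K) * K ^ m))"
    by (rule arg_cong)
  moreover have "fps_to_fls (\<Sum>j\<in>J. fps_const (a j) * K ^ j) = (\<Sum>j\<in>J. fls_const (a j) * f ^ j)" if "finite J" for J
    using that by (induction J) (simp_all add: f_def fls_times_fps_to_fls fps_to_fls_power)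
  ultimately have fm: "f ^ m = fls_X ^ m * ((\<Sum>j<m. fls_const (a j) * f ^ j) + R * f ^ m)"
    by (simp add: f_def R_def fls_times_fps_to_fls fps_to_fls_power)
  have fjxm: "f ^ j * x ^ m = x ^ (m - j)" if "j \<le> m" for j
  proof -
    have "f ^ j * x ^ m = (f * x) ^ j * x ^ (m - j)"
      using that by (simp add: power_mult_distrib mult.assoc flip: power_add)
    then show ?thesis by (simp add: fx)
  qed
  have "1 = f ^ m * x ^ m" by (simp add: fjxm)
  also have "\<dots> = fls_X ^ m * ((\<Sum>j<m. fls_const (a j) * f ^ j) + R * f ^ m) * x ^ m"
    by (rule arg_cong[OF fm])
  also have "\<dots> = fls_X ^ m * ((\<Sum>j<m. fls_const (a j) * (f ^ j * x ^ m)) + R * (f ^ m * x ^ m))"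
    by (simp only: mult.assoc distrib_right sum_distrib_right)
  finally have X: "1 = fls_X ^ m * ((\<Sum>j<m. fls_const (a j) * x ^ (m - j)) + R)"
    by (simp add: fjxm)
  define D where "D = fls_deriv f"
  define E where "E = (\<Sum>j<m. fls_const (a j) * (D * x ^ (m - j))) + D * R"
  have "D = D * (fls_X ^ m * ((\<Sum>j<m. fls_const (a j) * x ^ (m - j)) + R))"
    unfolding X[symmetric] by simp
  also have "\<dots> = fls_X ^ m * E"
    by (simp add: E_def distrib_left sum_distrib_left mult.left_commute)
  finally have D: "D = fls_shift (- int m) E"
    by (simp only: fls_X_power_times_conv_shift)
  have "of_nat m * K $ m = D $$ (int m - 1)"
    using m by (simp add: D_def f_def)
  also have "\<dots> = E $$ -1"
    by (subst D) simp
  also have "\<dots> = (\<Sum>j<m. a j * (D * x ^ (m - j)) $$ -1) + (D * R) $$ -1"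
    by (simp add: E_def fls_nth_sum)
  also have "(D * R) $$ -1 = 0"
    by (simp add: D_def R_def f_def fls_deriv_fps_to_fls flip: fls_times_fps_to_fls)
  also have "(\<Sum>j<m. a j * (D * x ^ (m - j)) $$ -1) = (\<Sum>j<m. if j = m - 1 then a j else 0)"
  proof (rule sum.cong[OF refl])
    fix j assume "j \<in> {..<m}"
    then have "m - j = Suc (m - 1 - j)" "m - 1 - j = 0 \<longleftrightarrow> j = m - 1" by auto
    then show "a j * (D * x ^ (m - j)) $$ -1 = (if j = m - 1 then a j else 0)"
      using fls_residue_deriv_times_inverse_power[of f "m - 1 - j"]
      by (simp add: D_def x_def f_def fls_subdegree_fls_to_fps sub)
  qed
  also have "\<dots> = a (m - 1)" using m by simp
  finally show ?thesis by (simp add: a_def)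
qed

lemma fps_const_plus_X_power_nth:
  "((fps_const c + fps_X) ^ m) $ j = (of_nat (m choose j) * c ^ (m - j) :: 'a::comm_ring_1)"
proof -
  have "((fps_X + fps_const c) ^ m) $ j = (\<Sum>k\<le>m. (of_nat (m choose k) * fps_X ^ k * fps_const c ^ (m - k)) $ j)"
    by (simp add: binomial_ring fps_sum_nth)
  also have "\<dots> = (\<Sum>k\<le>m. if k = j then of_nat (m choose k) * c ^ (m - k) else 0)"
    by (intro sum.cong refl)
       (simp add: fps_const_power fps_of_nat[symmetric] fps_X_power_nth mult.assoc mult.commute[of "fps_X ^ _"])
  also have "\<dots> = of_nat (m choose j) * c ^ (m - j)"
    by (auto simp: not_le binomial_eq_0)
  finally show ?thesis by (simp add: add.commute)
qed

text \<open>Lagrange inversion with \<open>\<phi> = (p + X) (q + X)\<close>: the two binomial coefficients of the Narayana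
  numbers come from the two factors of \<open>\<phi>\<^sup>m\<close>.\<close>
lemma narayana_series_nth:
  fixes p q :: "'a::field_char_0" and K :: "'a fps"
  assumes K: "K = fps_X * ((fps_const p + K) * (fps_const q + K))"
    and pq: "p \<noteq> 0" "q \<noteq> 0" and m: "m \<ge> 1"
  shows "K $ m = p ^ Suc m * assoc_narayana m (q / p)"
proof -
  define \<phi> where "\<phi> = (fps_const p + fps_X) * (fps_const q + fps_X)"
  have K0: "K $ 0 = 0" by (subst K) simp
  have "of_nat m * K $ m = (\<phi> ^ m) $ (m - 1)"
  proof (rule lagrange_inversion[OF _ _ m])
    show "K = fps_X * (\<phi> oo K)"
      using K by (simp add: \<phi>_def fps_compose_mult_distrib[OF K0] fps_compose_add_distrib K0)
    show "\<phi> $ 0 \<noteq> 0" using pq by (simp add: \<phi>_def)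
  qed
  also have "\<dots> = (\<Sum>j=0..m - 1. of_nat (m choose j) * p ^ (m - j) * (of_nat (m choose (m - 1 - j)) * q ^ (m - (m - 1 - j))))"
    unfolding \<phi>_def power_mult_distrib fps_mult_nth fps_const_plus_X_power_nth ..
  also have "\<dots> = (\<Sum>j=0..m - 1. p ^ Suc m * (of_nat (m choose j) * of_nat (m choose Suc j) * (q / p) ^ Suc j))"
  proof (intro sum.cong refl)
    fix j assume "j \<in> {0..m - 1}"
    then have "m - (m - 1 - j) = Suc j" and "Suc m = m - j + Suc j" and "j < m" using m by auto
    moreover have "m choose (m - 1 - j) = m choose Suc j"
      using binomial_symmetric[of "Suc j" m] \<open>j < m\<close> by simp
    moreover have "p ^ (m - j + Suc j) * (q / p) ^ Suc j = p ^ (m - j) * q ^ Suc j"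
      using pq by (simp only: power_add power_divide) simp
    ultimately show "of_nat (m choose j) * p ^ (m - j) * (of_nat (m choose (m - 1 - j)) * q ^ (m - (m - 1 - j))) =
        p ^ Suc m * (of_nat (m choose j) * of_nat (m choose Suc j) * (q / p) ^ Suc j)"
      by (simp only: ac_simps)
  qed
  also have "\<dots> = (\<Sum>k=1..m. p ^ Suc m * (of_nat (m choose (k - 1)) * of_nat (m choose k) * (q / p) ^ k))"
    using m by (intro sum.reindex_bij_witness[of _ "\<lambda>k. k - 1" Suc]) auto
  also have "\<dots> = of_nat m * (p ^ Suc m * assoc_narayana m (q / p))"
    using m by (simp add: assoc_narayana_def sum_distrib_left ac_simps)
  finally show ?thesis using m by simp
qed

lemma substitution_equation:
  assumes "is_substitution v"
  shows "v $ 0 = 0" and "v = fps_X * (1 + v)\<^sup>2"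
proof -
  show v0: "v $ 0 = 0" using assms by (simp add: is_substitution_def)
  have "((1 + v)\<^sup>2) $ 0 \<noteq> 0" using v0 by (simp add: fps_power_zeroth)
  then have "v / (1 + v)\<^sup>2 * (1 + v)\<^sup>2 = v"
    by (simp add: fps_divide_unit mult.assoc inverse_mult_eq_1)
  then show "v = fps_X * (1 + v)\<^sup>2"
    using assms by (simp add: is_substitution_def)
qed

text \<open>Lagrange inversion with \<open>\<phi> = (1 + X)\<^sup>2\<close>.\<close>
lemma substitution_nth:
  assumes v: "is_substitution v" and m: "m \<ge> 1"
  shows "v $ m = catalan m"
proof -
  note eq = substitution_equation[OF v]
  have "real m * v $ m = (((fps_const 1 + fps_X)\<^sup>2) ^ m) $ (m - 1)"
  proof (rule lagrange_inversion[OF _ _ m])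
    have "(fps_const 1 + fps_X)\<^sup>2 oo v = (1 + v)\<^sup>2"
      using eq(1) by (simp add: fps_compose_power[symmetric] fps_compose_add_distrib)
    then show "v = fps_X * ((fps_const 1 + fps_X)\<^sup>2 oo v)"
      using eq(2) by simp
  qed (simp add: fps_power_zeroth)
  also have "\<dots> = real (2 * m choose (m - 1))"
    by (simp only: power_mult[symmetric] fps_const_plus_X_power_nth power_one mult_1_right)
  also have "\<dots> = real m * catalan m"
  proof -
    have "m * (2 * m choose m) = (m + 1) * (2 * m choose (m - 1))"
      using binomial_absorption[of "m - 1" "2 * m"] binomial_absorb_comp[of "2 * m" "m - 1"] m by simp
    then have "real m * real (2 * m choose m) = (real m + 1) * real (2 * m choose (m - 1))"
      by (metis of_nat_mult of_nat_add of_nat_1)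
    then show ?thesis by (simp add: catalan_def field_simps)
  qed
  finally show ?thesis using m by simp
qed

lemma substitution_quotient_nth:
  assumes v: "is_substitution v" and n: "n \<ge> 1"
  shows "(v * inverse (1 + v)) $ n = catalan (n - 1)"
proof -
  note eq = substitution_equation[OF v]
  have "v * inverse (1 + v) = fps_X * (1 + v) * ((1 + v) * inverse (1 + v))"
    by (subst (1) eq(2)) (simp add: power2_eq_square mult.assoc)
  also have "(1 + v) * inverse (1 + v) = 1"
    using eq(1) by (simp add: inverse_mult_eq_1')
  finally show ?thesis
    using n substitution_nth[OF v, of "n - 1"] eq(1)
    by (cases "n - 1") (auto simp: catalan_def)
qed

section \<open>Solving the quadratic equation\<close>

text \<open>The assumption on \<open>w\<^sup>2\<close> says that \<open>w\<close> is a square root of the discriminant at \<open>y = 0\<close>, the one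
  that belongs to the chosen constant coefficient of \<open>H\<close>.  The assumptions on \<open>A\<close> and \<open>B\<close> identify
  the other two coefficients of the discriminant.\<close>
lemma quadratic_series_nth:
  fixes H :: "'a::field_char_0 fps" and a b w A B :: 'a
  assumes H: "H\<^sup>2 - H + (1 + fps_X) * fps_const a - (1 + fps_X)\<^sup>2 * fps_const b = 0"
    and H0: "H $ 0 = (1 - w) / 2"
    and w: "w \<noteq> 0" "w\<^sup>2 = 1 - 4 * a + 4 * b"
    and A: "w\<^sup>2 * A = a - 2 * b" and B: "w\<^sup>2 * B\<^sup>2 = b"
    and nz: "A + B \<noteq> 0" "A - B \<noteq> 0"
  shows "H $ 1 = w * A"
    and "d \<ge> 2 \<Longrightarrow> H $ d = w * (A + B) ^ d * assoc_narayana (d - 1) ((A - B) / (A + B))"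
proof -
  let ?c = fps_const
  define K where "K = ?c (1 / w) * fps_shift 1 (H - ?c (H $ 0)) - ?c A"
  have "H = ?c (H $ 0) + fps_X * fps_shift 1 (H - ?c (H $ 0))"
    by (rule fps_ext) auto
  also have "fps_shift 1 (H - ?c (H $ 0)) = ?c w * (?c A + K)"
    using w(1) by (simp add: K_def flip: mult.assoc)
  finally have H_eq: "H = ?c ((1 - w) / 2) + fps_X * (?c w * (?c A + K))"
    unfolding H0 .
  have half: "2 * ?c ((1 - w) / 2) = 1 - ?c w"
    by (simp add: numeral_fps_const flip: fps_const_sub)
  have w2: "(?c w)\<^sup>2 = 1 - 4 * ?c a + 4 * ?c b"
    using arg_cong[OF w(2), of ?c] by (simp add: numeral_fps_const fps_const_power flip: fps_const_1_eq_1)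
  have A': "(?c w)\<^sup>2 * ?c A = ?c a - 2 * ?c b"
    using arg_cong[OF A, of ?c] by (simp add: numeral_fps_const fps_const_power)
  have B': "(?c w)\<^sup>2 * (?c B)\<^sup>2 = ?c b"
    using arg_cong[OF B, of ?c] by (simp add: fps_const_power)
  \<comment> \<open>Completing the square: \<open>H - 1/2 = - w/2 + w y (A + K)\<close>, so the constant terms cancel and a
    factor \<open>w\<^sup>2 y\<close> splits off.\<close>
  have "4 * (?c w)\<^sup>2 * fps_X * (K - fps_X * ((?c A + K)\<^sup>2 - (?c B)\<^sup>2)) = 0"
    using H[unfolded H_eq] half w2 A' B' by algebra
  then have "K = fps_X * ((?c A + K)\<^sup>2 - (?c B)\<^sup>2)"
    using w(1) by simp
  also have "(?c A + K)\<^sup>2 - (?c B)\<^sup>2 = (?c (A + B) + K) * (?c (A - B) + K)"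
    unfolding fps_const_add[symmetric] fps_const_sub[symmetric] by algebra
  finally have K: "K = fps_X * ((?c (A + B) + K) * (?c (A - B) + K))" .
  then have "K $ 0 = 0" by (metis fps_X_mult_nth)
  then show "H $ 1 = w * A" by (subst H_eq) simp
  assume "d \<ge> 2"
  then have "H $ d = w * K $ (d - 1)"
    by (subst H_eq) (simp add: fps_X_mult_nth)
  also have "K $ (d - 1) = (A + B) ^ Suc (d - 1) * assoc_narayana (d - 1) ((A - B) / (A + B))"
    by (rule narayana_series_nth[OF K nz]) (use \<open>d \<ge> 2\<close> in simp)
  also have "Suc (d - 1) = d"
    using \<open>d \<ge> 2\<close> by simp
  finally show "H $ d = w * (A + B) ^ d * assoc_narayana (d - 1) ((A - B) / (A + B))"
    by (simp only: mult.assoc)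
qed

section \<open>The parameters as rational functions of \<open>u\<close>\<close>

lemma fps_to_fls_divide_unit:
  fixes f g :: "'a::field fps"
  assumes "g $ 0 \<noteq> 0"
  shows "fps_to_fls (f / g) = fps_to_fls f / fps_to_fls g"
proof -
  have "fps_to_fls (f / g) * fps_to_fls g = fps_to_fls (f / g * g)"
    by (simp add: fls_times_fps_to_fls)
  also have "f / g * g = f"
    using assms by (simp add: fps_divide_unit mult.assoc inverse_mult_eq_1)
  finally show ?thesis
    using assms by (auto simp: eq_divide_eq)
qed

text \<open>One step of the iteration in terms of \<open>u\<close>, with \<open>x = u\<^sup>r\<close>; the new values on the left-hand sides
  are those for \<open>u\<^sup>r\<^sup>+\<^sup>1 = u x\<close>.\<close>
lemma rho_parameters_step:
  fixes u x z t q :: "'a::field"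
  assumes nz: "1 + u \<noteq> 0" "1 - u * x \<noteq> 0" "1 - u\<^sup>2 * x \<noteq> 0" "1 - u ^ 3 * x \<noteq> 0"
    and z: "z = u * (1 - u * x) / ((1 + u) * (1 - u\<^sup>2 * x))"
    and t: "t = u * x * (1 - u)\<^sup>2 / ((1 + u) * (1 - u * x) * (1 - u\<^sup>2 * x))"
    and q: "q = u * x * (1 - u)\<^sup>2 / ((1 - u * x) * (1 - u ^ 3 * x))"
  shows "q * (1 - z) = t"
    and "u * (1 - u\<^sup>2 * x) / ((1 + u) * (1 - u ^ 3 * x)) = z * (1 + q)"
    and "u\<^sup>2 * x * (1 - u)\<^sup>2 / ((1 + u) * (1 - u\<^sup>2 * x) * (1 - u ^ 3 * x)) = z * q"
proof -
  \<comment> \<open>Opaque denominators keep the simplifier from multiplying them out.\<close>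
  define D where "D k = 1 - u ^ k * x" for k
  have D: "D 1 \<noteq> 0" "D 2 \<noteq> 0" "D 3 \<noteq> 0" using nz by (simp_all add: D_def)
  have z: "z = u * D 1 / ((1 + u) * D 2)" using z by (simp add: D_def)
  have t: "t = u * x * (1 - u)\<^sup>2 / ((1 + u) * D 1 * D 2)" using t by (simp add: D_def)
  have q: "q = u * x * (1 - u)\<^sup>2 / (D 1 * D 3)" using q by (simp add: D_def)
  have "1 - z = ((1 + u) * D 2 - u * D 1) / ((1 + u) * D 2)"
    using nz(1) D unfolding z by (simp add: diff_divide_distrib)
  also have "(1 + u) * D 2 - u * D 1 = D 3"
    unfolding D_def by algebra
  finally show "q * (1 - z) = t"
    using nz(1) D unfolding q t by simp
  have "1 + q = (D 1 * D 3 + u * x * (1 - u)\<^sup>2) / (D 1 * D 3)"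
    using D unfolding q by (simp add: add_divide_distrib)
  also have "D 1 * D 3 + u * x * (1 - u)\<^sup>2 = (D 2)\<^sup>2"
    unfolding D_def by algebra
  finally have "u * D 2 / ((1 + u) * D 3) = z * (1 + q)"
    using nz(1) D unfolding z by (simp add: power2_eq_square)
  then show "u * (1 - u\<^sup>2 * x) / ((1 + u) * (1 - u ^ 3 * x)) = z * (1 + q)"
    by (simp add: D_def)
  have "u\<^sup>2 * x * (1 - u)\<^sup>2 / ((1 + u) * D 2 * D 3) = z * q"
    using nz(1) D unfolding z q by (simp add: power2_eq_square ac_simps)
  then show "u\<^sup>2 * x * (1 - u)\<^sup>2 / ((1 + u) * (1 - u\<^sup>2 * x) * (1 - u ^ 3 * x)) = z * q"
    by (simp add: D_def)
qed

text \<open>The closed forms of \<open>a = z\<close> and \<open>a - t\<close> make the coefficient \<open>b\<close> of the quadratic equation the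
  square \<open>(u s / (1 + u))\<^sup>2\<close>, which is where the square root \<open>s\<close> in the result comes from.  The last
  two identities express \<open>(A - B) / (A + B) = (A - B)\<^sup>2 / ((A + B) (A - B))\<close> through \<open>u\<close> and \<open>s\<close>; here
  \<open>s\<^sup>2\<close> can be eliminated, and only the mixed term of the square keeps a factor \<open>s\<close>.\<close>
lemma series_parameters:
  fixes u x s a t b w A B :: "'a::field_char_0"
  assumes nz: "1 + u \<noteq> 0" "1 - u \<noteq> 0" "1 - u * x \<noteq> 0" "1 - u\<^sup>2 * x \<noteq> 0"
    and s: "s\<^sup>2 * (1 - u\<^sup>2 * x) = 1 - x"
    and a: "a = u * (1 - u * x) / ((1 + u) * (1 - u\<^sup>2 * x))"
    and t: "t = u * x * (1 - u)\<^sup>2 / ((1 + u) * (1 - u * x) * (1 - u\<^sup>2 * x))"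
    and b: "b = a * (a - t)"
    and w: "w = (1 - u) / (1 + u)"
    and A: "A = u * (1 + u * x) / ((1 - u) * (1 - u\<^sup>2 * x))"
    and B: "B = u / (1 - u) * s"
  shows "w\<^sup>2 * B\<^sup>2 = b" and "w\<^sup>2 * A = a - 2 * b" and "w\<^sup>2 = 1 - 4 * a + 4 * b"
    and "(A + B) * (A - B) = u\<^sup>2 * x * (1 + u)\<^sup>2 / ((1 - u)\<^sup>2 * (1 - u\<^sup>2 * x)\<^sup>2)"
    and "(A - B)\<^sup>2 = u\<^sup>2 * (2 * u\<^sup>2 * x\<^sup>2 - u\<^sup>2 * x + 2 * u * x - x + 2
            - 2 * (1 + u * x) * (1 - u\<^sup>2 * x) * s) / ((1 - u)\<^sup>2 * (1 - u\<^sup>2 * x)\<^sup>2)"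
proof -
  define D where "D = 1 - u\<^sup>2 * x"
  have D: "D \<noteq> 0" using nz by (simp add: D_def)
  have "a - t = u * (1 - x) / ((1 + u) * (1 - u * x))"
  proof -
    have "a - t = (u * (1 - u * x)\<^sup>2 - u * x * (1 - u)\<^sup>2) / ((1 + u) * (1 - u * x) * D)"
      using nz D unfolding a t D_def[symmetric] by (simp add: diff_divide_eq_iff divide_diff_eq_iff power2_eq_square)
    also have "u * (1 - u * x)\<^sup>2 - u * x * (1 - u)\<^sup>2 = u * (1 - x) * D"
      unfolding D_def by algebra
    finally show ?thesis using D by simp
  qed
  then have b_eq: "b = (u / (1 + u))\<^sup>2 * s\<^sup>2"
    using nz D unfolding b a s[symmetric] D_def[symmetric] by (simp add: power2_eq_square)
  then show wB: "w\<^sup>2 * B\<^sup>2 = b"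
    using nz unfolding w B by (simp add: power_mult_distrib power_divide)
  have sD: "s\<^sup>2 = (1 - x) / D"
    using s D by (simp add: D_def eq_divide_eq)
  have a_eq: "a = u * (1 - u * x) / ((1 + u) * D)" unfolding a D_def ..
  have b_eq': "b = u\<^sup>2 * (1 - x) / ((1 + u)\<^sup>2 * D)"
    unfolding b_eq sD by (simp add: power_divide)
  show "w\<^sup>2 * A = a - 2 * b"
  proof -
    have "a - 2 * b = (u * (1 - u * x) * (1 + u) - 2 * (u\<^sup>2 * (1 - x))) / ((1 + u)\<^sup>2 * D)"
      using nz D unfolding a_eq b_eq' by (simp add: diff_divide_distrib power2_eq_square)
    also have "u * (1 - u * x) * (1 + u) - 2 * (u\<^sup>2 * (1 - x)) = u * (1 - u) * (1 + u * x)"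
      by algebra
    finally show ?thesis
      using nz D unfolding w A D_def[symmetric] by (simp add: power2_eq_square ac_simps)
  qed
  show "w\<^sup>2 = 1 - 4 * a + 4 * b"
  proof -
    have "1 - 4 * a + 4 * b = ((1 + u)\<^sup>2 * D - 4 * (u * (1 - u * x) * (1 + u)) + 4 * (u\<^sup>2 * (1 - x))) / ((1 + u)\<^sup>2 * D)"
      using nz D unfolding a_eq b_eq' by (simp add: diff_divide_distrib add_divide_distrib power2_eq_square)
    also have "(1 + u)\<^sup>2 * D - 4 * (u * (1 - u * x) * (1 + u)) + 4 * (u\<^sup>2 * (1 - x)) = (1 - u)\<^sup>2 * D"
      unfolding D_def by algebra
    finally show ?thesis
      using D unfolding w by (simp add: power_divide)
  qed
  have A_eq: "A = u * (1 + u * x) / ((1 - u) * D)" unfolding A D_def ..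
  have B_eq: "B = u * (D * s) / ((1 - u) * D)" using D unfolding B by simp
  have s': "D * s\<^sup>2 = 1 - x" using s by (simp add: D_def mult.commute)
  have "(A + B) * (A - B) = (u * (1 + u * x) + u * (D * s)) * (u * (1 + u * x) - u * (D * s)) / ((1 - u)\<^sup>2 * D\<^sup>2)"
    unfolding A_eq B_eq add_divide_distrib[symmetric] diff_divide_distrib[symmetric]
    by (simp add: power2_eq_square ac_simps)
  also have "(u * (1 + u * x) + u * (D * s)) * (u * (1 + u * x) - u * (D * s)) = u\<^sup>2 * x * (1 + u)\<^sup>2"
    using s' unfolding D_def by algebra
  finally show "(A + B) * (A - B) = u\<^sup>2 * x * (1 + u)\<^sup>2 / ((1 - u)\<^sup>2 * (1 - u\<^sup>2 * x)\<^sup>2)"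
    by (simp add: D_def)
  have "(A - B)\<^sup>2 = (u * (1 + u * x) - u * (D * s))\<^sup>2 / ((1 - u)\<^sup>2 * D\<^sup>2)"
    unfolding A_eq B_eq diff_divide_distrib[symmetric] by (simp add: power_divide power_mult_distrib)
  also have "(u * (1 + u * x) - u * (D * s))\<^sup>2 = u\<^sup>2 * (2 * u\<^sup>2 * x\<^sup>2 - u\<^sup>2 * x + 2 * u * x - x + 2
            - 2 * (1 + u * x) * D * s)"
    using s' unfolding D_def by algebra
  finally show "(A - B)\<^sup>2 = u\<^sup>2 * (2 * u\<^sup>2 * x\<^sup>2 - u\<^sup>2 * x + 2 * u * x - x + 2
            - 2 * (1 + u * x) * (1 - u\<^sup>2 * x) * s) / ((1 - u)\<^sup>2 * (1 - u\<^sup>2 * x)\<^sup>2)"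
    by (simp add: D_def)
qed

text \<open>The values of \<open>(z, t)\<close> after \<open>r\<close> steps of the iteration that starts at \<open>(X, X)\<close>, and the total
  weight \<open>q\<close> of the attached paths in the next step.\<close>
definition z_series :: "real fps \<Rightarrow> nat \<Rightarrow> real fps" where
  "z_series v r = v * (1 - v ^ (r + 1)) / ((1 + v) * (1 - v ^ (r + 2)))"

definition t_series :: "real fps \<Rightarrow> nat \<Rightarrow> real fps" where
  "t_series v r = v ^ (r + 1) * (1 - v)\<^sup>2 / ((1 + v) * (1 - v ^ (r + 1)) * (1 - v ^ (r + 2)))"

definition q_series :: "real fps \<Rightarrow> nat \<Rightarrow> real fps" where
  "q_series v r = v ^ (r + 1) * (1 - v)\<^sup>2 / ((1 - v ^ (r + 1)) * (1 - v ^ (r + 3)))"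

lemma z_series_nth_0: "v $ 0 = 0 \<Longrightarrow> z_series v r $ 0 = 0"
  and t_series_nth_0: "v $ 0 = 0 \<Longrightarrow> t_series v r $ 0 = 0"
  unfolding z_series_def t_series_def
  by (subst fps_divide_unit; simp)+

lemma fps_to_fls_nonzero: "f $ 0 \<noteq> 0 \<Longrightarrow> fps_to_fls f \<noteq> 0"
  by auto

context
  fixes v :: "real fps" and u :: "real fls"
  assumes v0: "v $ 0 = 0" and u: "u = fps_to_fls v"
begin

lemma denominators_nonzero:
  "1 + u \<noteq> 0" "1 - u \<noteq> 0" "1 - u * u ^ r \<noteq> 0" "1 - u\<^sup>2 * u ^ r \<noteq> 0" "1 - u ^ 3 * u ^ r \<noteq> 0"
  using v0 fps_to_fls_nonzero[of "1 + v"] fps_to_fls_nonzero[of "1 - v"]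
    fps_to_fls_nonzero[of "1 - v * v ^ r"] fps_to_fls_nonzero[of "1 - v\<^sup>2 * v ^ r"]
    fps_to_fls_nonzero[of "1 - v ^ 3 * v ^ r"]
  by (simp_all add: u fls_times_fps_to_fls fps_to_fls_power power2_eq_square power3_eq_cube)

lemma z_series_to_fls:
  "fps_to_fls (z_series v r) = u * (1 - u * u ^ r) / ((1 + u) * (1 - u\<^sup>2 * u ^ r))"
  unfolding z_series_def using v0
  by (subst fps_to_fls_divide_unit)
     (simp_all add: u fls_times_fps_to_fls fps_to_fls_power power2_eq_square mult.assoc)

lemma t_series_to_fls:
  "fps_to_fls (t_series v r) = u * u ^ r * (1 - u)\<^sup>2 / ((1 + u) * (1 - u * u ^ r) * (1 - u\<^sup>2 * u ^ r))"
  unfolding t_series_def using v0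
  by (subst fps_to_fls_divide_unit)
     (simp_all add: u fls_times_fps_to_fls fps_to_fls_power power2_eq_square mult.assoc)

lemma q_series_to_fls:
  "fps_to_fls (q_series v r) = u * u ^ r * (1 - u)\<^sup>2 / ((1 - u * u ^ r) * (1 - u ^ 3 * u ^ r))"
proof -
  have "v ^ (r + 3) = v ^ 3 * v ^ r"
    by (simp only: power_add mult.commute)
  then show ?thesis
    unfolding q_series_def using v0
    by (subst fps_to_fls_divide_unit)
       (simp_all add: u fls_times_fps_to_fls fps_to_fls_power fps_power_zeroth)
qed

lemma sqrt_series_to_fls: "(fps_to_fls (sqrt_series r v))\<^sup>2 * (1 - u\<^sup>2 * u ^ r) = 1 - u ^ r"
proof -
  have "(fps_to_fls (sqrt_series r v))\<^sup>2 = fps_to_fls ((1 - v ^ r) / (1 - v ^ (r + 2)))"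
    using sqrt_series(1)[OF v0, of r] by (simp only: fps_to_fls_power[symmetric])
  also have "\<dots> = (1 - u ^ r) / (1 - u\<^sup>2 * u ^ r)"
    using v0 by (subst fps_to_fls_divide_unit)
      (simp_all add: u fls_times_fps_to_fls fps_to_fls_power power2_eq_square mult.assoc)
  finally show ?thesis
    using denominators_nonzero(4)[of r] by simp
qed

end

text \<open>The identities hold for the Laurent series, where division is unrestricted, and embedding power
  series into Laurent series is injective.\<close>
lemma parameters_step:
  assumes "v $ 0 = 0"
  shows "q_series v r * (1 - z_series v r) = t_series v r"
    and "z_series v (Suc r) = z_series v r * (1 + q_series v r)"
    and "t_series v (Suc r) = z_series v r * q_series v r"
proof -
  define u where "u = fps_to_fls v"
  note nz = denominators_nonzero[OF assms u_def]
  note to_fls = z_series_to_fls[OF assms u_def] t_series_to_fls[OF assms u_def] q_series_to_fls[OF assms u_def]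
  note step = rho_parameters_step[OF nz(1) nz(3-5)[of r] to_fls(1)[of r] to_fls(2)[of r] to_fls(3)[of r]]
  have "fps_to_fls (q_series v r * (1 - z_series v r)) = fps_to_fls (t_series v r)"
    using step(1) by (simp add: fls_times_fps_to_fls)
  then show "q_series v r * (1 - z_series v r) = t_series v r"
    by (simp only: fps_to_fls_eq_iff)
  have "fps_to_fls (z_series v (Suc r)) = fps_to_fls (z_series v r * (1 + q_series v r))"
    unfolding to_fls(1)[of "Suc r"] using step(2)
    by (simp add: fls_times_fps_to_fls power2_eq_square power3_eq_cube mult.assoc)
  then show "z_series v (Suc r) = z_series v r * (1 + q_series v r)"
    by (simp only: fps_to_fls_eq_iff)
  have "fps_to_fls (t_series v (Suc r)) = fps_to_fls (z_series v r * q_series v r)"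
    unfolding to_fls(2)[of "Suc r"] using step(3)
    by (simp add: fls_times_fps_to_fls power2_eq_square power3_eq_cube mult.assoc)
  then show "t_series v (Suc r) = z_series v r * q_series v r"
    by (simp only: fps_to_fls_eq_iff)
qed

lemma parameters_start:
  assumes "is_substitution v"
  shows "z_series v 0 = fps_X" and "t_series v 0 = fps_X"
proof -
  define u where "u = fps_to_fls v"
  note eq = substitution_equation[OF assms]
  note nz = denominators_nonzero[OF eq(1) u_def]
  have "u = fps_to_fls fps_X * (1 + u)\<^sup>2"
    unfolding u_def by (subst eq(2)) (simp only: fls_times_fps_to_fls fps_to_fls_power fps_to_fls_plus fps_one_to_fls)
  then have X: "fps_to_fls fps_X = u / (1 + u)\<^sup>2"
    using nz(1) by (simp add: eq_divide_eq)
  have diff: "1 - u\<^sup>2 = (1 - u) * (1 + u)"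
    by (simp add: power2_eq_square algebra_simps)
  have "fps_to_fls (z_series v 0) = fps_to_fls fps_X" "fps_to_fls (t_series v 0) = fps_to_fls fps_X"
    unfolding X z_series_to_fls[OF eq(1) u_def] t_series_to_fls[OF eq(1) u_def]
    using nz(1,2) by (simp_all add: diff) (simp_all add: power2_eq_square)
  then show "z_series v 0 = fps_X" and "t_series v 0 = fps_X"
    by (simp_all only: fps_to_fls_eq_iff)
qed

section \<open>Factorial moments\<close>

text \<open>The expansion of \<open>(1 + y)\<^sup>k\<close> makes the size after \<open>r\<close> cuts appear as a binomial coefficient.\<close>
lemma binomial_moment_series:
  assumes v: "is_substitution v"
  shows "\<exists>G. (\<forall>d n. (\<Sum>\<tau>\<in>plane_trees n. real (X r \<tau> choose d)) = G $ d $ n) \<and>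
    G\<^sup>2 - G + (1 + fps_X) * fps_const (z_series v r)
      - (1 + fps_X)\<^sup>2 * fps_const (z_series v r * (z_series v r - t_series v r)) = 0"
proof -
  note v0 = substitution_equation(1)[OF v]
  note zt0 = z_series_nth_0[OF v0] t_series_nth_0[OF v0]
  obtain G where G: "\<And>d. has_formal_sum
        (\<lambda>\<tau>. ((1 + fps_X) ^ nodes \<tau>) $ d * weight (z_series v r) (t_series v r) \<tau>) UNIV (G $ d)"
      and quad: "G\<^sup>2 - G + (1 + fps_X) * fps_const (z_series v r)
        - (1 + fps_X)\<^sup>2 * fps_const (z_series v r * (z_series v r - t_series v r)) = 0"
    using size_marked_sum[OF zt0(1)[of r] zt0(2)[of r], of "1 + fps_X"] by blast
  have fibre: "has_formal_sum (weight fps_X fps_X) {\<tau>. (rho ^^ r) \<tau> = \<sigma>}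
      (weight (z_series v r) (t_series v r) \<sigma>)" for \<sigma>
    using has_formal_sum_iterated_rho_fibre[of "z_series v" "t_series v" "q_series v" r \<sigma>,
        OF zt0 parameters_step[OF v0]]
    by (simp add: parameters_start[OF v])
  have "(\<Sum>\<tau>\<in>plane_trees n. real (X r \<tau> choose d)) = G $ d $ n" for d n
  proof -
    have coeff: "((1 + fps_X) ^ k) $ d = (fps_const (real (k choose d)) :: real fps)" for k
      using fps_const_plus_X_power_nth[of "1 :: real fps" k d] by (simp add: fps_of_nat)
    show ?thesis
      unfolding X_def
      by (rule sum_plane_trees[OF fibre, where c = "\<lambda>\<sigma>. real (nodes \<sigma> choose d)"])
         (use G[of d] in \<open>simp add: coeff\<close>)
  qed
  with quad show ?thesis by blast
qed

text \<open>Lagrange inversion and the quotient \<open>Q\<close> need coefficients in a field, so the quadratic equation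
  is transported to Laurent series coefficients.\<close>
definition lift_fls :: "'a::comm_ring_1 fps fps \<Rightarrow> 'a fls fps" where
  "lift_fls F = Abs_fps (\<lambda>d. fps_to_fls (F $ d))"

lemma lift_fls_nth [simp]: "lift_fls F $ d = fps_to_fls (F $ d)"
  by (simp add: lift_fls_def)

lemma lift_fls_add: "lift_fls (F + G) = lift_fls F + lift_fls G"
  and lift_fls_diff: "lift_fls (F - G) = lift_fls F - lift_fls G"
  by (rule fps_ext, simp)+

lemma lift_fls_mult: "lift_fls (F * G) = lift_fls F * lift_fls G"
proof (rule fps_ext)
  fix n
  have "fps_to_fls (\<Sum>i\<in>I. F $ i * G $ (n - i)) = (\<Sum>i\<in>I. fps_to_fls (F $ i) * fps_to_fls (G $ (n - i)))"
    if "finite I" for I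
    using that by (induction I) (simp_all add: fls_times_fps_to_fls)
  then show "lift_fls (F * G) $ n = (lift_fls F * lift_fls G) $ n"
    by (simp add: fps_mult_nth)
qed

lemma lift_fls_const: "lift_fls (fps_const c) = fps_const (fps_to_fls c)"
  and lift_fls_X: "lift_fls fps_X = fps_X"
  and lift_fls_1: "lift_fls 1 = 1"
  and lift_fls_0: "lift_fls 0 = 0"
  by (rule fps_ext, simp add: fps_X_nth)+

lemma falling_factorial_of_nat: "falling_factorial (real m) d = fact d * real (m choose d)"
  by (simp add: falling_factorial_def binomial_gbinomial gbinomial_prod_rev atLeast0LessThan)

lemma expect_eq:
  assumes "n \<ge> 1"
  shows "expect n f = (\<Sum>\<tau>\<in>plane_trees n. f \<tau>) / real (card (plane_trees n))"
  unfolding expect_def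
  by (rule integral_pmf_of_set[OF plane_trees_nonempty[OF assms] finite_plane_trees])

theorem lemma5p4:
  fixes r n :: nat and v :: "real fps" and u s :: "real fls"
  assumes n: "n \<ge> 1"
    and v: "is_substitution v"
    and u: "u = fps_to_fls v"
    and s: "s = fps_to_fls (sqrt_series r v)"
  shows
    "expect n (\<lambda>t. real (X r t)) =
       1 / catalan (n - 1) *
         fls_nth (u * (1 + u ^ (r + 1)) / ((1 + u) * (1 - u ^ (r + 2)))) (int n)
     \<and> expect n (\<lambda>t. real (X r t) * (real (X r t) - 1)) =
       2 / catalan (n - 1) *
         fls_nth ((1 + u) * u ^ (r + 2) / ((1 - u) * (1 - u ^ (r + 2))\<^sup>2)) (int n)
     \<and> (\<forall>d\<ge>2. expect n (\<lambda>t. falling_factorial (real (X r t)) d) =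
       fact d / catalan (n - 1) *
         fls_nth ((1 - u) / (1 + u)
           * (u * (1 + u ^ (r + 1)) / ((1 - u) * (1 - u ^ (r + 2))) + u / (1 - u) * s) ^ d
           * assoc_narayana (d - 1) (Q r u s)) (int n))"
proof -
  note v0 = substitution_equation(1)[OF v]
  note nz = denominators_nonzero[OF v0 u]
  define x where "x = u ^ r"
  define a where "a = fps_to_fls (z_series v r)"
  define t where "t = fps_to_fls (t_series v r)"
  define b where "b = a * (a - t)"
  define w where "w = (1 - u) / (1 + u)"
  define A where "A = u * (1 + u * x) / ((1 - u) * (1 - u\<^sup>2 * x))"
  define B where "B = u / (1 - u) * s"
  have pow: "u ^ (r + 1) = u * x" "u ^ (r + 2) = u\<^sup>2 * x" "u ^ (2 * r + 2) = u\<^sup>2 * x\<^sup>2"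
    by (simp_all add: x_def power_add power_mult power2_eq_square mult.commute)
  have x_nz: "x \<noteq> 0" and u_nz: "u \<noteq> 0"
  proof -
    have "v $ 1 = catalan 1" by (rule substitution_nth[OF v]) simp
    then have "v \<noteq> 0" by (auto simp: catalan_def)
    then show "u \<noteq> 0" "x \<noteq> 0" by (auto simp: u x_def)
  qed
  note param = series_parameters[OF nz(1,2) nz(3,4)[of r, folded x_def]
      sqrt_series_to_fls[OF v0 u, of r, folded x_def s]
      z_series_to_fls[OF v0 u, of r, folded a_def x_def]
      t_series_to_fls[OF v0 u, of r, folded t_def x_def]
      b_def w_def A_def B_def]
  have w_nz: "w \<noteq> 0" using nz(1,2) by (simp add: w_def)
  have AB: "A + B \<noteq> 0" "A - B \<noteq> 0"
    using param(4) nz(1,2) nz(4)[of r, folded x_def] x_nz u_nz by auto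
  \<comment> \<open>The extension by \<open>A - B\<close> is the one under which the denominator becomes rational in \<open>u\<close>.\<close>
  have Q: "Q r u s = (A - B) / (A + B)"
  proof -
    have "(A - B) / (A + B) = (A - B)\<^sup>2 / ((A + B) * (A - B))"
      using AB by (simp add: power2_eq_square)
    also have "\<dots> = (2 * u\<^sup>2 * x\<^sup>2 - u\<^sup>2 * x + 2 * u * x - x + 2
            - 2 * (1 + u * x) * (1 - u\<^sup>2 * x) * s) / (x * (1 + u)\<^sup>2)"
      unfolding param(4,5) using nz(1,2) nz(4)[of r, folded x_def] x_nz u_nz by (simp add: mult.assoc)
    also have "\<dots> = Q r u s"
      unfolding Q_def pow x_def[symmetric] diff_divide_distrib by (simp add: ac_simps)
    finally show ?thesis ..
  qed

  obtain G where G: "\<And>d n. (\<Sum>\<tau>\<in>plane_trees n. real (X r \<tau> choose d)) = G $ d $ n"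
    and quad: "G\<^sup>2 - G + (1 + fps_X) * fps_const (z_series v r)
      - (1 + fps_X)\<^sup>2 * fps_const (z_series v r * (z_series v r - t_series v r)) = 0"
    using binomial_moment_series[OF v] by blast
  define H where "H = lift_fls G"
  have quadH: "H\<^sup>2 - H + (1 + fps_X) * fps_const a - (1 + fps_X)\<^sup>2 * fps_const b = 0"
    using arg_cong[OF quad, of lift_fls]
    by (simp only: lift_fls_add lift_fls_diff lift_fls_mult lift_fls_const lift_fls_X lift_fls_1 lift_fls_0
        power2_eq_square H_def a_def b_def t_def fls_times_fps_to_fls fps_to_fls_minus)
  have T: "fps_to_fls (v * inverse (1 + v)) = (1 - w) / 2" "fps_to_fls (inverse (1 + v)) = (1 + w) / 2"
  proof -
    have inv: "fps_to_fls (inverse (1 + v)) = 1 / (1 + u)"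
      using fps_to_fls_divide_unit[of "1 + v" 1] v0 by (simp add: u fps_divide_unit)
    have "w * (1 + u) = 1 - u"
      using nz(1) by (simp add: w_def)
    then have eqs: "(1 - w) * (1 + u) = u * 2" "(1 + w) * (1 + u) = 1 * 2"
      by algebra+
    have Tw: "(1 - w) / 2 = u / (1 + u)" "(1 + w) / 2 = 1 / (1 + u)"
      by (subst frac_eq_eq, simp, rule nz(1), rule eqs)+
    show "fps_to_fls (v * inverse (1 + v)) = (1 - w) / 2" "fps_to_fls (inverse (1 + v)) = (1 + w) / 2"
      unfolding Tw fls_times_fps_to_fls inv u[symmetric] by simp_all
  qed
  \<comment> \<open>At \<open>y = 0\<close> the quadratic equation has the solutions \<open>u / (1 + u)\<close> and \<open>1 / (1 + u)\<close>; there being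
    no tree without nodes rules out the second one.\<close>
  have G0: "G $ 0 = v * inverse (1 + v)"
  proof -
    have "(H\<^sup>2 - H + (1 + fps_X) * fps_const a - (1 + fps_X)\<^sup>2 * fps_const b) $ 0 = 0"
      by (simp only: quadH fps_zero_nth)
    then have "(H $ 0)\<^sup>2 - H $ 0 + a - b = 0"
      by (simp add: power2_eq_square)
    then have "(2 * H $ 0 - (1 - w)) * (2 * H $ 0 - (1 + w)) = 0"
      using param(3) by algebra
    then consider "H $ 0 = (1 - w) / 2" | "H $ 0 = (1 + w) / 2"
      by (auto simp: eq_divide_eq mult.commute)
    then show ?thesis
    proof cases
      case 1
      then show ?thesis unfolding T(1)[symmetric] H_def by simp
    next
      case 2
      then have "G $ 0 = inverse (1 + v)" unfolding T(2)[symmetric] H_def by simp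
      then have "G $ 0 $ 0 = 1" using v0 by simp
      moreover have "plane_trees 0 = {}"
        using nodes_pos by (auto simp: plane_trees_def Suc_le_eq)
      ultimately show ?thesis using G[of 0 0] by simp
    qed
  qed
  have H0: "H $ 0 = (1 - w) / 2"
    by (simp add: H_def G0 T(1))
  note H = quadratic_series_nth[OF quadH H0 w_nz param(3,2,1) AB]

  have card: "real (card (plane_trees n)) = catalan (n - 1)"
    using G[of 0 n] by (simp add: G0 substitution_quotient_nth[OF v n])
  have moment: "expect n (\<lambda>t. falling_factorial (real (X r t)) d) = fact d / catalan (n - 1) * fls_nth (H $ d) (int n)" for d
    unfolding expect_eq[OF n] card falling_factorial_of_nat sum_distrib_left[symmetric] G
    by (simp add: H_def)
  show ?thesis
  proof (intro conjI allI impI)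
    have "H $ 1 = u * (1 + u ^ (r + 1)) / ((1 + u) * (1 - u ^ (r + 2)))"
      unfolding H(1) w_def A_def pow using nz(1,2) by simp
    then show "expect n (\<lambda>t. real (X r t)) = 1 / catalan (n - 1) *
         fls_nth (u * (1 + u ^ (r + 1)) / ((1 + u) * (1 - u ^ (r + 2)))) (int n)"
      using moment[of 1] by (simp add: falling_factorial_def)
    have "H $ 2 = w * ((A + B) * (A - B))"
      using AB by (simp add: H(2) assoc_narayana_def power2_eq_square)
    also have "\<dots> = (1 + u) * u ^ (r + 2) / ((1 - u) * (1 - u ^ (r + 2))\<^sup>2)"
      unfolding param(4) w_def pow using nz(1,2) by (simp add: power2_eq_square)
    finally show "expect n (\<lambda>t. real (X r t) * (real (X r t) - 1)) = 2 / catalan (n - 1) *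
         fls_nth ((1 + u) * u ^ (r + 2) / ((1 - u) * (1 - u ^ (r + 2))\<^sup>2)) (int n)"
      using moment[of 2] by (simp add: falling_factorial_def numeral_2_eq_2 lessThan_Suc mult.commute)
    fix d :: nat
    assume "d \<ge> 2"
    then have "H $ d = (1 - u) / (1 + u)
           * (u * (1 + u ^ (r + 1)) / ((1 - u) * (1 - u ^ (r + 2))) + u / (1 - u) * s) ^ d
           * assoc_narayana (d - 1) (Q r u s)"
      unfolding Q pow w_def[symmetric] A_def[symmetric] B_def[symmetric] by (rule H(2))
    then show "expect n (\<lambda>t. falling_factorial (real (X r t)) d) =
       fact d / catalan (n - 1) *
         fls_nth ((1 - u) / (1 + u)
           * (u * (1 + u ^ (r + 1)) / ((1 - u) * (1 - u ^ (r + 2))) + u / (1 - u) * s) ^ d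
           * assoc_narayana (d - 1) (Q r u s)) (int n)"
      by (simp only: moment)
  qed
qed

end
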